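(* Let $d \geq 3$ be fixed. Then $$\frac{r_{\mathrm{max}}^*(n,d)}{r_{\mathrm{gen}}(n,d)} \to 0 \qquad \text{as } n \to \infty.$$
   Context: All polynomials have complex coefficients. For a homogeneous polynomial $F(x_1,\dotsc,x_n)$ of degree $d$, the Waring rank $r(F)$ is the least number $r$ of terms needed to write $F = c_1 \ell_1^d + \dotsb + c_r \ell_r^d$ with $c_i \in \mathbb{C}$ and $\ell_i$ homogeneous linear forms in $x_1,\dotsc,x_n$. The generic Waring rank $r_{\mathrm{gen}}(n,d)$ is the value of $r(F)$ that holds for all $F$ in a dense Zariski open subset of the space of homogeneous polynomials of degree $d$ in $n$ variables. By the Alexander--Hirschowitz theorem, $r_{\mathrm{gen}}(n,d) = \left\lceil \frac{1}{n} \binom{d+n-1}{n-1} \right\rceil$, except that $r_{\mathrm{gen}}(n,2)=n$, $r_{\mathrm{gen}}(3,4)=6$, $r_{\mathrm{gen}}(4,4)=10$, $r_{\mathrm{gen}}(5,3)=8$, and $r_{\mathrm{gen}}(5,4)=15$. A sum of pairwise coprime monomials of degree $d$ is a form $M_1 + \dotsb + M_t$ where the $M_i$ are monomials of degree $d$ involving pairwise disjoint sets of variables. $r_{\mathrm{max}}^*(n,d)$ denotes the maximum Waring rank of a sum of pairwise coprime monomials of degree $d$ in $n$ variables. *)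

theory Defs
  imports "HOL-Analysis.Analysis" "HOL-Library.Poly_Mapping"
begin

text \<open>
  A monomial is its exponent function of type \<open>'v \<Rightarrow>\<^sub>0 nat\<close>, and a polynomial is a finitely supported
  map from monomials to complex coefficients, with the convolution product of
  \<open>HOL-Library.Poly_Mapping\<close>. The variables \<open>x\<^sub>1, \<dots>, x\<^sub>n\<close> are indexed by \<open>0, \<dots>, n - 1\<close>.
\<close>

type_synonym 'v monomial = "'v \<Rightarrow>\<^sub>0 nat"
type_synonym 'v mpoly = "'v monomial \<Rightarrow>\<^sub>0 complex"

definition mon_degree :: "'v monomial \<Rightarrow> nat" where
  "mon_degree m = (\<Sum>v\<in>Poly_Mapping.keys m. Poly_Mapping.lookup m v)"

definition monomials :: "nat \<Rightarrow> nat \<Rightarrow> nat monomial set" where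
  "monomials n d = {m. Poly_Mapping.keys m \<subseteq> {..<n} \<and> mon_degree m = d}"

definition forms :: "nat \<Rightarrow> nat \<Rightarrow> nat mpoly set" where
  "forms n d = {F. Poly_Mapping.keys F \<subseteq> monomials n d}"

definition const :: "complex \<Rightarrow> 'v mpoly" where
  "const c = Poly_Mapping.single 0 c"

definition waring_rank :: "nat \<Rightarrow> nat \<Rightarrow> nat mpoly \<Rightarrow> nat" where
  "waring_rank n d F =
     (LEAST r. \<exists>(c :: nat \<Rightarrow> complex) (l :: nat \<Rightarrow> nat mpoly).
        (\<forall>i<r. l i \<in> forms n 1) \<and> F = (\<Sum>i<r. const (c i) * l i ^ d))"

definition mon_eval :: "('v \<Rightarrow> complex) \<Rightarrow> 'v monomial \<Rightarrow> complex" where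
  "mon_eval x m = (\<Prod>v\<in>Poly_Mapping.keys m. x v ^ Poly_Mapping.lookup m v)"

definition mpoly_eval :: "('v \<Rightarrow> complex) \<Rightarrow> 'v mpoly \<Rightarrow> complex" where
  "mpoly_eval x P = (\<Sum>m\<in>Poly_Mapping.keys P. Poly_Mapping.lookup P m * mon_eval x m)"

lemma mon_eval_superset:
  assumes "finite A" "Poly_Mapping.keys m \<subseteq> A"
  shows "mon_eval x m = (\<Prod>v\<in>A. x v ^ Poly_Mapping.lookup m v)"
  unfolding mon_eval_def using assms
  by (intro prod.mono_neutral_left) (auto simp: in_keys_iff)

lemma mon_eval_add: "mon_eval x (m + m') = mon_eval x m * mon_eval x m'"
proof -
  let ?A = "Poly_Mapping.keys m \<union> Poly_Mapping.keys m'"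
  have "Poly_Mapping.keys (m + m') \<subseteq> ?A"
    by (rule Poly_Mapping.keys_add)
  then show ?thesis
    by (simp add: mon_eval_superset[of ?A] lookup_add power_add prod.distrib)
qed

lemma mpoly_eval_superset:
  assumes "finite A" "Poly_Mapping.keys P \<subseteq> A"
  shows "mpoly_eval x P = (\<Sum>m\<in>A. Poly_Mapping.lookup P m * mon_eval x m)"
  unfolding mpoly_eval_def using assms
  by (intro sum.mono_neutral_left) (auto simp: in_keys_iff)

lemma mpoly_eval_0: "mpoly_eval x 0 = 0"
  by (simp add: mpoly_eval_def)

lemma mpoly_eval_1: "mpoly_eval x 1 = 1"
  by (simp add: mpoly_eval_def mon_eval_def)

lemma mpoly_eval_add: "mpoly_eval x (P + Q) = mpoly_eval x P + mpoly_eval x Q"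
proof -
  let ?A = "Poly_Mapping.keys P \<union> Poly_Mapping.keys Q"
  have "Poly_Mapping.keys (P + Q) \<subseteq> ?A"
    by (rule Poly_Mapping.keys_add)
  then show ?thesis
    by (simp add: mpoly_eval_superset[of ?A] lookup_add distrib_right sum.distrib)
qed

lemma mpoly_eval_single: "mpoly_eval x (Poly_Mapping.single m c) = c * mon_eval x m"
  by (simp add: mpoly_eval_superset[of "{m}"])

lemma sum_single_lookup:
  "(\<Sum>m\<in>Poly_Mapping.keys P. Poly_Mapping.single m (Poly_Mapping.lookup P m)) = P"
proof (rule poly_mapping_eqI)
  fix k
  have "Poly_Mapping.lookup
      (\<Sum>m\<in>Poly_Mapping.keys P. Poly_Mapping.single m (Poly_Mapping.lookup P m)) k =
      (\<Sum>m\<in>Poly_Mapping.keys P. if m = k then Poly_Mapping.lookup P m else 0)"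
    by (simp add: lookup_sum lookup_single when_def)
  also have "\<dots> = Poly_Mapping.lookup P k"
    by (simp add: sum.delta in_keys_iff)
  finally show "Poly_Mapping.lookup
      (\<Sum>m\<in>Poly_Mapping.keys P. Poly_Mapping.single m (Poly_Mapping.lookup P m)) k =
      Poly_Mapping.lookup P k" .
qed

lemma mpoly_induct [case_names zero single add]:
  fixes P :: "'v mpoly"
  assumes "Q 0" "\<And>m c. Q (Poly_Mapping.single m c)" "\<And>P P'. Q P \<Longrightarrow> Q P' \<Longrightarrow> Q (P + P')"
  shows "Q P"
proof -
  have "Q (\<Sum>m\<in>A. Poly_Mapping.single m (Poly_Mapping.lookup P m))" if "finite A" for A
    using that by (induction A) (auto intro: assms)
  from this[of "Poly_Mapping.keys P"] show ?thesis
    by (simp add: sum_single_lookup)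
qed

lemma mpoly_eval_mult: "mpoly_eval x (P * Q) = mpoly_eval x P * mpoly_eval x Q"
proof (induction P rule: mpoly_induct)
  case (single m c)
  show ?case
    by (induction Q rule: mpoly_induct)
      (simp_all add: mpoly_eval_0 mpoly_eval_add mpoly_eval_single mult_single mon_eval_add
        distrib_left)
qed (simp_all add: mpoly_eval_0 mpoly_eval_add distrib_right)

text \<open>
  The Zariski topology on the affine space of forms: the coordinates of a form are its
  coefficients, so polynomial functions on this space are polynomials in variables indexed by
  monomials, evaluated at \<open>Poly_Mapping.lookup F\<close>. Closed sets are the common zero sets of
  arbitrary sets of such polynomials.
\<close>

definition zariski_open :: "nat \<Rightarrow> nat \<Rightarrow> nat mpoly set \<Rightarrow> bool" where
  "zariski_open n d U \<longleftrightarrow>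
     (\<exists>S :: nat monomial mpoly set.
        U = forms n d - {F \<in> forms n d. \<forall>P\<in>S. mpoly_eval (Poly_Mapping.lookup F) P = 0})"

definition zariski :: "nat \<Rightarrow> nat \<Rightarrow> nat mpoly topology" where
  "zariski n d = topology (zariski_open n d)"

lemma istopology_zariski_open: "istopology (zariski_open n d)"
  unfolding istopology_def
proof (intro conjI allI impI)
  fix U V assume "zariski_open n d U" "zariski_open n d V"
  then obtain S T where
    S: "U = forms n d - {F \<in> forms n d. \<forall>P\<in>S. mpoly_eval (Poly_Mapping.lookup F) P = 0}" and
    T: "V = forms n d - {F \<in> forms n d. \<forall>P\<in>T. mpoly_eval (Poly_Mapping.lookup F) P = 0}"
    by (auto simp: zariski_open_def)
  have "U \<inter> V = forms n d - {F \<in> forms n d.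
      \<forall>P\<in>{P * Q | P Q. P \<in> S \<and> Q \<in> T}. mpoly_eval (Poly_Mapping.lookup F) P = 0}"
    (is "_ = ?W")
  proof (intro set_eqI iffI)
    fix F assume "F \<in> U \<inter> V"
    then obtain P Q where "F \<in> forms n d" "P \<in> S" "Q \<in> T"
      "mpoly_eval (Poly_Mapping.lookup F) P \<noteq> 0" "mpoly_eval (Poly_Mapping.lookup F) Q \<noteq> 0"
      unfolding S T by blast
    moreover from this have "mpoly_eval (Poly_Mapping.lookup F) (P * Q) \<noteq> 0"
      by (simp add: mpoly_eval_mult)
    ultimately show "F \<in> ?W"
      by blast
  next
    fix F assume "F \<in> ?W"
    then obtain P Q where "F \<in> forms n d" "P \<in> S" "Q \<in> T"
      "mpoly_eval (Poly_Mapping.lookup F) (P * Q) \<noteq> 0"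
      by blast
    moreover from this have
      "mpoly_eval (Poly_Mapping.lookup F) P \<noteq> 0" "mpoly_eval (Poly_Mapping.lookup F) Q \<noteq> 0"
      by (simp_all add: mpoly_eval_mult)
    ultimately show "F \<in> U \<inter> V"
      unfolding S T by blast
  qed
  then show "zariski_open n d (U \<inter> V)"
    unfolding zariski_open_def by blast
next
  fix \<U> assume "\<forall>U\<in>\<U>. zariski_open n d U"
  then have "\<forall>U\<in>\<U>. \<exists>S. U =
      forms n d - {F \<in> forms n d. \<forall>P\<in>S. mpoly_eval (Poly_Mapping.lookup F) P = 0}"
    unfolding zariski_open_def .
  from bchoice[OF this] obtain S where S: "\<forall>U\<in>\<U>. U =
      forms n d - {F \<in> forms n d. \<forall>P\<in>S U. mpoly_eval (Poly_Mapping.lookup F) P = 0}"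
    by (rule exE)
  have "\<Union>\<U> = (\<Union>U\<in>\<U>. U)"
    by simp
  also have "\<dots> = (\<Union>U\<in>\<U>. forms n d -
      {F \<in> forms n d. \<forall>P\<in>S U. mpoly_eval (Poly_Mapping.lookup F) P = 0})"
    by (rule SUP_cong[OF refl]) (rule S[rule_format])
  also have "\<dots> = forms n d -
      {F \<in> forms n d. \<forall>P\<in>(\<Union>U\<in>\<U>. S U). mpoly_eval (Poly_Mapping.lookup F) P = 0}"
    by auto
  finally show "zariski_open n d (\<Union>\<U>)"
    unfolding zariski_open_def by blast
qed

lemma openin_zariski: "openin (zariski n d) U \<longleftrightarrow> zariski_open n d U"
  by (simp add: zariski_def topology_inverse'[OF istopology_zariski_open])

lemma topspace_zariski: "topspace (zariski n d) = forms n d"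
proof -
  have "zariski_open n d (forms n d)"
    unfolding zariski_open_def by (rule exI[of _ "{1}"]) (auto simp: mpoly_eval_1)
  moreover have "U \<subseteq> forms n d" if "zariski_open n d U" for U
    using that by (auto simp: zariski_open_def)
  ultimately show ?thesis
    unfolding topspace_def openin_zariski by blast
qed

definition generic_waring_rank :: "nat \<Rightarrow> nat \<Rightarrow> nat" where
  "generic_waring_rank n d =
     (THE r. \<exists>U. openin (zariski n d) U \<and> zariski n d closure_of U = topspace (zariski n d) \<and>
        (\<forall>F\<in>U. waring_rank n d F = r))"

text \<open>
  Monomials are taken with coefficient 1; rescaling the disjoint sets of variables absorbs nonzero
  complex coefficients without changing the Waring rank. Not all \<open>n\<close> variables need occur.
\<close>

definition coprime_monomial_sums :: "nat \<Rightarrow> nat \<Rightarrow> nat mpoly set" where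
  "coprime_monomial_sums n d =
     {\<Sum>i<t. Poly_Mapping.single (M i) 1 | (t :: nat) (M :: nat \<Rightarrow> nat monomial).
        t \<ge> 1 \<and> (\<forall>i<t. M i \<in> monomials n d) \<and>
        (\<forall>i<t. \<forall>j<t. i \<noteq> j \<longrightarrow> Poly_Mapping.keys (M i) \<inter> Poly_Mapping.keys (M j) = {})}"

definition max_coprime_waring_rank :: "nat \<Rightarrow> nat \<Rightarrow> nat" where
  "max_coprime_waring_rank n d = Max (waring_rank n d ` coprime_monomial_sums n d)"

end

theory Submission
  imports Defs "HOL-Computational_Algebra.Fundamental_Theorem_Algebra"
begin

text \<open>
  For fixed \<open>d \<ge> 3\<close> the two ranks grow at different rates. A monomial of degree \<open>d\<close> is a sum of
  \<open>2 ^ d\<close> powers of linear forms by polarization, and at most \<open>n\<close> monomials of positive degree in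
  \<open>n\<close> variables can be pairwise coprime. Sums of coprime monomials thus have rank at most
  \<open>n * 2 ^ d\<close> (\<open>max_coprime_waring_rank_le\<close>). On the other hand, a sum of \<open>r\<close> powers depends
  on only \<open>r * (n + 1)\<close> parameters, while forms live in a space whose dimension is the number of monomials,
  at least \<open>n choose d \<ge> (n / d) ^ d\<close>. So the generic rank is at least of order \<open>n ^ (d - 1)\<close>
  (\<open>card_monomials_le_generic_waring_rank\<close>). Since \<open>d \<ge> 3\<close>, the
  quotient is \<open>O(1 / n)\<close>.

  The generic rank is a definite description, so a comparison with it requires that a generic value
  exists (\<open>generic_waring_rank_attained\<close>). The forms that are sums of \<open>r\<close> powers are the image of a
  polynomial map, hence constructible by Chevalley's theorem (\<open>constructible_image\<close>), which is
  obtained here by eliminating one variable after the other. A constructible set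
  of forms contains a nonempty open set or is disjoint from one (\<open>constructible_forms_dichotomy\<close>), and
  nonempty open sets are dense because the space of forms is irreducible (\<open>nonvanishing_mult\<close>).
  The least \<open>r\<close> for which the first alternative holds is the generic rank.

  The lower bound comes from counting monomials: polynomials outnumbering their variables
  satisfy a nontrivial relation (\<open>algebraic_dependence\<close>), so for small \<open>r\<close> a nonzero polynomial
  vanishes on all sums of \<open>r\<close> powers.
\<close>

section \<open>Evaluation of polynomials\<close>

lemma mpoly_eval_uminus: "mpoly_eval x (- P) = - mpoly_eval x P"
  using mpoly_eval_add[of x P "- P"] by (simp add: mpoly_eval_0 eq_neg_iff_add_eq_0 add.commute)

lemma mpoly_eval_diff: "mpoly_eval x (P - Q) = mpoly_eval x P - mpoly_eval x Q"
  using mpoly_eval_add[of x P "- Q"] by (simp add: mpoly_eval_uminus)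

lemma mpoly_eval_sum: "mpoly_eval x (\<Sum>i\<in>A. P i) = (\<Sum>i\<in>A. mpoly_eval x (P i))"
  by (induction A rule: infinite_finite_induct) (simp_all add: mpoly_eval_0 mpoly_eval_add)

lemma mpoly_eval_prod: "mpoly_eval x (\<Prod>i\<in>A. P i) = (\<Prod>i\<in>A. mpoly_eval x (P i))"
  by (induction A rule: infinite_finite_induct) (simp_all add: mpoly_eval_1 mpoly_eval_mult)

lemma mpoly_eval_power: "mpoly_eval x (P ^ k) = mpoly_eval x P ^ k"
  by (induction k) (simp_all add: mpoly_eval_1 mpoly_eval_mult)

lemma mon_eval_0: "mon_eval x 0 = 1"
  by (simp add: mon_eval_def)

lemma mon_eval_single: "mon_eval x (Poly_Mapping.single v k) = x v ^ k"
  by (simp add: mon_eval_superset[of "{v}"])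

lemmas mpoly_eval_simps = mpoly_eval_0 mpoly_eval_1 mpoly_eval_add mpoly_eval_uminus mpoly_eval_diff
  mpoly_eval_mult mpoly_eval_sum mpoly_eval_prod mpoly_eval_power mpoly_eval_single
  mon_eval_0 mon_eval_single mon_eval_add

definition var :: "'v \<Rightarrow> 'v mpoly" where
  "var v = Poly_Mapping.single (Poly_Mapping.single v 1) 1"

lemma mpoly_eval_var [simp]: "mpoly_eval x (var v) = x v"
  by (simp add: var_def mpoly_eval_simps)

abbreviation eval_coeffs :: "('v \<Rightarrow> complex) \<Rightarrow> 'v mpoly poly \<Rightarrow> complex poly" where
  "eval_coeffs z \<equiv> map_poly (mpoly_eval z)"

lemma coeff_eval_coeffs: "coeff (eval_coeffs z p) n = mpoly_eval z (coeff p n)"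
  by (simp add: coeff_map_poly mpoly_eval_0)

lemma eval_coeffs_add: "eval_coeffs z (p + q) = eval_coeffs z p + eval_coeffs z q"
  by (intro poly_eqI) (simp add: coeff_eval_coeffs mpoly_eval_simps)

lemma eval_coeffs_diff: "eval_coeffs z (p - q) = eval_coeffs z p - eval_coeffs z q"
  by (intro poly_eqI) (simp add: coeff_eval_coeffs mpoly_eval_simps)

lemma eval_coeffs_smult: "eval_coeffs z (smult a p) = smult (mpoly_eval z a) (eval_coeffs z p)"
  by (intro poly_eqI) (simp add: coeff_eval_coeffs mpoly_eval_simps)

lemma eval_coeffs_monom: "eval_coeffs z (monom a n) = monom (mpoly_eval z a) n"
  by (intro poly_eqI) (simp add: coeff_eval_coeffs mpoly_eval_simps)

lemma eval_coeffs_mult: "eval_coeffs z (p * q) = eval_coeffs z p * eval_coeffs z q"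
  by (intro poly_eqI) (simp add: coeff_eval_coeffs coeff_mult mpoly_eval_simps)

lemma eval_coeffs_1: "eval_coeffs z 1 = 1"
  by (simp add: mpoly_eval_1)

lemma eval_coeffs_power: "eval_coeffs z (p ^ k) = eval_coeffs z p ^ k"
  by (induction k) (simp_all add: eval_coeffs_mult eval_coeffs_1 mpoly_eval_1)

lemmas eval_coeffs_simps = eval_coeffs_add eval_coeffs_diff eval_coeffs_smult eval_coeffs_monom
  eval_coeffs_mult eval_coeffs_1 eval_coeffs_power

text \<open>
  This turns a projection along \<open>v\<close> into a question about univariate polynomials with
  parameters. The value of \<open>z\<close> at \<open>v\<close> has no influence on the right-hand side, because \<open>p\<close> is
  chosen with coefficients free of \<open>v\<close>.
\<close>

lemma mpoly_as_univariate:
  fixes P :: "'v mpoly"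
  shows "\<exists>p. \<forall>z x. mpoly_eval (z(v := x)) P = poly (eval_coeffs z p) x"
proof (induction P rule: mpoly_induct)
  case zero
  show ?case by (rule exI[of _ 0]) (simp add: mpoly_eval_0)
next
  case (single m c)
  define k where "k = Poly_Mapping.lookup m v"
  define m' where "m' = m - Poly_Mapping.single v k"
  have m: "m = m' + Poly_Mapping.single v k"
    by (rule poly_mapping_eqI) (auto simp: m'_def k_def lookup_add lookup_minus lookup_single when_def)
  have v: "v \<notin> Poly_Mapping.keys m'"
    by (simp add: m'_def k_def in_keys_iff lookup_minus)
  have "mon_eval (z(v := x)) m' = mon_eval z m'" for z :: "'v \<Rightarrow> complex" and x
    unfolding mon_eval_def using v by (intro prod.cong) auto
  then have "mpoly_eval (z(v := x)) (Poly_Mapping.single m c)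
      = poly (eval_coeffs z (monom (Poly_Mapping.single m' c) k)) x" for z x
    by (subst m) (simp add: mpoly_eval_simps eval_coeffs_simps poly_monom)
  then show ?case by blast
next
  case (add P P')
  then obtain p p' where "\<And>z x. mpoly_eval (z(v := x)) P = poly (eval_coeffs z p) x"
    "\<And>z x. mpoly_eval (z(v := x)) P' = poly (eval_coeffs z p') x" by blast
  then have "mpoly_eval (z(v := x)) (P + P') = poly (eval_coeffs z (p + p')) x" for z x
    by (simp add: mpoly_eval_simps eval_coeffs_simps)
  then show ?case by blast
qed


section \<open>Constructible sets and elimination of a variable\<close>

definition piece :: "'v mpoly set \<Rightarrow> 'v mpoly \<Rightarrow> ('v \<Rightarrow> complex) set" where
  "piece F g = {z. (\<forall>f\<in>F. mpoly_eval z f = 0) \<and> mpoly_eval z g \<noteq> 0}"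

text \<open>
  Constructible sets are taken in disjunctive normal form. This is the form in which a variable
  is eliminated, and closure under Boolean operations is easily recovered from it.
\<close>

definition constructible :: "('v \<Rightarrow> complex) set \<Rightarrow> bool" where
  "constructible S \<longleftrightarrow>
     (\<exists>Q. finite Q \<and> (\<forall>(F, g)\<in>Q. finite F) \<and> S = (\<Union>(F, g)\<in>Q. piece F g))"

lemma constructible_piece: "finite F \<Longrightarrow> constructible (piece F g)"
  unfolding constructible_def by (rule exI[of _ "{(F, g)}"]) simp

lemma constructible_Un:
  assumes "constructible S" "constructible T"
  shows "constructible (S \<union> T)"
proof -
  obtain Q R where Q: "finite Q" "\<forall>(F, g)\<in>Q. finite F" "S = (\<Union>(F, g)\<in>Q. piece F g)"
    and R: "finite R" "\<forall>(F, g)\<in>R. finite F" "T = (\<Union>(F, g)\<in>R. piece F g)"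
    using assms unfolding constructible_def by blast
  then show ?thesis
    unfolding constructible_def by (intro exI[of _ "Q \<union> R"]) auto
qed

lemma piece_Int: "piece F g \<inter> piece G h = piece (F \<union> G) (g * h)"
  by (auto simp: piece_def mpoly_eval_mult)

lemma constructible_Int:
  assumes "constructible S" "constructible T"
  shows "constructible (S \<inter> T)"
proof -
  obtain Q R where Q: "finite Q" "\<forall>(F, g)\<in>Q. finite F" "S = (\<Union>(F, g)\<in>Q. piece F g)"
    and R: "finite R" "\<forall>(F, g)\<in>R. finite F" "T = (\<Union>(F, g)\<in>R. piece F g)"
    using assms unfolding constructible_def by blast
  define W where "W = (\<lambda>((F, g), (G, h)). (F \<union> G, g * h)) ` (Q \<times> R)"
  have "S \<inter> T = (\<Union>(F, g)\<in>Q. \<Union>(G, h)\<in>R. piece F g \<inter> piece G h)"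
    unfolding Q R by (auto simp: split_beta)
  also have "\<dots> = (\<Union>(F, g)\<in>W. piece F g)"
    unfolding W_def piece_Int by force
  finally show ?thesis
    unfolding constructible_def using Q R by (intro exI[of _ W]) (auto simp: W_def)
qed

lemma constructible_empty: "constructible {}"
  unfolding constructible_def by (intro exI[of _ "{}"]) auto

lemma constructible_UNIV: "constructible UNIV"
  using constructible_piece[of "{}" 1] by (simp add: piece_def mpoly_eval_1)

lemma constructible_UN:
  "finite I \<Longrightarrow> (\<And>i. i \<in> I \<Longrightarrow> constructible (S i)) \<Longrightarrow> constructible (\<Union>i\<in>I. S i)"
  by (induction I rule: finite_induct) (auto intro: constructible_empty constructible_Un)

lemma constructible_INT:
  "finite I \<Longrightarrow> (\<And>i. i \<in> I \<Longrightarrow> constructible (S i)) \<Longrightarrow> constructible (\<Inter>i\<in>I. S i)"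
  by (induction I rule: finite_induct) (auto intro: constructible_UNIV constructible_Int)

lemma constructible_zero: "constructible {z. mpoly_eval z f = 0}"
  using constructible_piece[of "{f}" 1] by (simp add: piece_def mpoly_eval_1)

lemma constructible_nonzero: "constructible {z. mpoly_eval z f \<noteq> 0}"
  using constructible_piece[of "{}" f] by (simp add: piece_def)

lemma constructible_Compl:
  assumes "constructible S"
  shows "constructible (- S)"
proof -
  obtain Q where Q: "finite Q" "\<forall>(F, g)\<in>Q. finite F" "S = (\<Union>(F, g)\<in>Q. piece F g)"
    using assms unfolding constructible_def by blast
  have "- S = (\<Inter>(F, g)\<in>Q. (\<Union>f\<in>F. {z. mpoly_eval z f \<noteq> 0}) \<union> {z. mpoly_eval z g = 0})"
    unfolding Q(3) piece_def by auto
  then show ?thesis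
    using Q(1,2) by (auto intro!: constructible_INT constructible_Un constructible_UN
        constructible_zero constructible_nonzero)
qed

lemma constructible_eval_coeffs_eq_0: "constructible {z. eval_coeffs z r = 0}"
proof -
  have "{z. eval_coeffs z r = 0} = (\<Inter>i\<in>{..degree r}. {z. mpoly_eval z (coeff r i) = 0})"
  proof (intro set_eqI iffI)
    fix z assume z: "z \<in> (\<Inter>i\<in>{..degree r}. {z. mpoly_eval z (coeff r i) = 0})"
    have "coeff (eval_coeffs z r) i = 0" for i
      using z by (cases "i \<le> degree r") (auto simp: coeff_eval_coeffs coeff_eq_0 mpoly_eval_0)
    then show "z \<in> {z. eval_coeffs z r = 0}" by (auto intro: poly_eqI)
  qed (auto simp: coeff_eval_coeffs[symmetric])
  then show ?thesis by (simp add: constructible_INT constructible_zero)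
qed

text \<open>
  The projection of a basic piece along one variable, once its polynomials are written as univariate ones.
\<close>

definition solvable_params :: "'v mpoly poly list \<Rightarrow> 'v mpoly poly \<Rightarrow> ('v \<Rightarrow> complex) set" where
  "solvable_params ps g =
     {z. \<exists>x. (\<forall>p\<in>set ps. poly (eval_coeffs z p) x = 0) \<and> poly (eval_coeffs z g) x \<noteq> 0}"

lemma solvable_params_Nil: "constructible (solvable_params [] g)"
proof -
  have "solvable_params [] g = - {z. eval_coeffs z g = 0}"
    using poly_all_0_iff_0 by (auto simp: solvable_params_def)
  then show ?thesis by (simp add: constructible_Compl constructible_eval_coeffs_eq_0)
qed

text \<open>
  As long as the leading coefficient of \<open>p\<close> does not vanish, every zero of \<open>p\<close> is a zero of \<open>g\<close>
  exactly if \<open>p\<close> divides \<open>g ^ degree p\<close>, by the fundamental theorem of algebra. Pseudo-division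
  detects divisibility with a remainder \<open>r\<close> that is computed once for all parameters.
\<close>

lemma solvable_params_single:
  assumes "p \<noteq> 0"
  shows "constructible (solvable_params [p] g \<inter> {z. mpoly_eval z (lead_coeff p) \<noteq> 0})"
proof -
  obtain q r where qr: "pseudo_divmod (g ^ degree p) p = (q, r)" by force
  define a where "a = lead_coeff p ^ (Suc (degree (g ^ degree p)) - degree p)"
  note pd = pseudo_divmod[OF assms qr, folded a_def]
  have *: "z \<in> solvable_params [p] g \<longleftrightarrow> eval_coeffs z r \<noteq> 0"
    if z: "mpoly_eval z (lead_coeff p) \<noteq> 0" for z
  proof -
    let ?p = "eval_coeffs z p" and ?g = "eval_coeffs z g" and ?r = "eval_coeffs z r"
    have deg: "degree ?p = degree p"
    proof (rule antisym)
      show "degree ?p \<le> degree p"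
        by (intro degree_le) (auto simp: coeff_eval_coeffs coeff_eq_0 mpoly_eval_0)
      show "degree p \<le> degree ?p"
        using z by (intro le_degree) (simp add: coeff_eval_coeffs)
    qed
    have a0: "mpoly_eval z a \<noteq> 0" using z by (simp add: a_def mpoly_eval_power)
    have eq: "smult (mpoly_eval z a) (?g ^ degree p) = ?p * eval_coeffs z q + ?r"
      using arg_cong[OF pd(1), of "eval_coeffs z"] by (simp add: eval_coeffs_simps)
    have p0: "?p \<noteq> 0" using z by (metis coeff_0 coeff_eval_coeffs)
    have "z \<notin> solvable_params [p] g \<longleftrightarrow> (\<forall>x. poly ?p x = 0 \<longrightarrow> poly ?g x = 0)"
      by (auto simp: solvable_params_def)
    also have "\<dots> \<longleftrightarrow> ?p dvd ?g ^ degree p"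
      using nullstellensatz_univariate[of ?p ?g] p0 deg by simp
    also have "\<dots> \<longleftrightarrow> ?p dvd smult (mpoly_eval z a) (?g ^ degree p)"
      using a0 by (simp add: dvd_smult_iff)
    also have "\<dots> \<longleftrightarrow> ?p dvd ?r"
      unfolding eq by (simp add: dvd_add_right_iff)
    also have "\<dots> \<longleftrightarrow> ?r = 0"
    proof
      assume dv: "?p dvd ?r"
      show "?r = 0"
      proof (rule ccontr)
        assume r0: "?r \<noteq> 0"
        then have "r \<noteq> 0" by auto
        then have "degree r < degree p" using pd(2) by auto
        moreover have "degree ?r \<le> degree r"
          by (intro degree_le) (auto simp: coeff_eval_coeffs coeff_eq_0 mpoly_eval_0)
        moreover have "degree ?p \<le> degree ?r" using dv r0 by (rule dvd_imp_degree_le)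
        ultimately show False using deg by simp
      qed
    qed simp
    finally show ?thesis by blast
  qed
  have "solvable_params [p] g \<inter> {z. mpoly_eval z (lead_coeff p) \<noteq> 0}
      = - {z. eval_coeffs z r = 0} \<inter> {z. mpoly_eval z (lead_coeff p) \<noteq> 0}"
    using * by auto
  then show ?thesis
    by (simp add: constructible_Int constructible_Compl constructible_eval_coeffs_eq_0
        constructible_nonzero)
qed

text \<open>
  Zero has a positive weight, so that deleting a zero equation from a system also makes progress,
  and it weighs less than a nonzero constant, so that losing the last coefficient does too.
\<close>

definition elim_weight :: "'a::zero poly \<Rightarrow> nat" where
  "elim_weight p = (if p = 0 then 1 else degree p + 2)"

lemma elim_weight_less:
  assumes "p \<noteq> 0" "degree q \<le> degree p" "coeff q (degree p) = 0"
  shows "elim_weight q < elim_weight p"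
  using assms eq_zero_or_degree_less[of q "degree p"] by (auto simp: elim_weight_def)

text \<open>
  Elimination by the Euclidean algorithm with parameters. Either the leading coefficient of some
  equation vanishes, and that equation can be truncated, or it may be used to lower the degree of
  another equation without changing the common zeros. One equation is left in the end.
\<close>

lemma constructible_solvable_params: "constructible (solvable_params ps g)"
proof (induction "sum_list (map elim_weight ps)" arbitrary: ps rule: less_induct)
  case less
  have reduct: "constructible (solvable_params (p # qs) g \<inter> {z. mpoly_eval z (lead_coeff p) = 0})"
    if "sum_list (map elim_weight (p # qs)) = sum_list (map elim_weight ps)" "p \<noteq> 0" for p qs
  proof -
    define p' where "p' = p - monom (lead_coeff p) (degree p)"
    have "elim_weight p' < elim_weight p"
      using that(2) by (intro elim_weight_less)
        (auto simp: p'_def degree_monom_le intro!: degree_diff_le)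
    then have "constructible (solvable_params (p' # qs) g)"
      using that(1) by (intro less) simp
    moreover have "solvable_params (p # qs) g \<inter> {z. mpoly_eval z (lead_coeff p) = 0}
        = solvable_params (p' # qs) g \<inter> {z. mpoly_eval z (lead_coeff p) = 0}"
      by (auto simp: solvable_params_def p'_def eval_coeffs_simps)
    ultimately show ?thesis by (simp add: constructible_Int constructible_zero)
  qed
  have split: "constructible S"
    if "constructible (S \<inter> {z. mpoly_eval z a = 0})" "constructible (S \<inter> {z. mpoly_eval z a \<noteq> 0})"
    for S and a :: "'a mpoly"
  proof -
    have "S = (S \<inter> {z. mpoly_eval z a = 0}) \<union> (S \<inter> {z. mpoly_eval z a \<noteq> 0})" by auto
    then show ?thesis using constructible_Un[OF that] by simp
  qed
  have pair: "constructible (solvable_params (p # q # qs) g)"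
    if w: "sum_list (map elim_weight (p # q # qs)) = sum_list (map elim_weight ps)"
      and nz: "p \<noteq> 0" "q \<noteq> 0" and le: "degree p \<le> degree q" for p q qs
  proof (rule split[OF reduct[OF w nz(1)]])
    define k where "k = degree q - degree p"
    \<comment> \<open>One step of pseudo-division: the leading terms cancel, and \<open>q\<close> can be recovered from \<open>q'\<close>
       and \<open>p\<close> wherever the leading coefficient of \<open>p\<close> does not vanish.\<close>
    define q' where "q' = smult (lead_coeff p) q - monom (lead_coeff q) k * p"
    have "degree q' \<le> degree q"
      unfolding q'_def
    proof (rule degree_diff_le)
      show "degree (monom (lead_coeff q) k * p) \<le> degree q"
        using degree_mult_le[of "monom (lead_coeff q) k" p] degree_monom_le[of "lead_coeff q" k] le
        by (simp add: k_def)
    qed (simp add: degree_smult_le)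
    moreover have "coeff q' (degree q) = 0"
      using le by (simp add: q'_def k_def coeff_monom_mult mult.commute[of "lead_coeff p" "lead_coeff q"])
    ultimately have "elim_weight q' < elim_weight q"
      using nz(2) by (intro elim_weight_less)
    then have "constructible (solvable_params (p # q' # qs) g)"
      using w by (intro less) simp
    moreover have "solvable_params (p # q # qs) g \<inter> {z. mpoly_eval z (lead_coeff p) \<noteq> 0}
        = solvable_params (p # q' # qs) g \<inter> {z. mpoly_eval z (lead_coeff p) \<noteq> 0}"
      by (auto simp: solvable_params_def q'_def eval_coeffs_simps)
    ultimately show "constructible
        (solvable_params (p # q # qs) g \<inter> {z. mpoly_eval z (lead_coeff p) \<noteq> 0})"
      by (simp add: constructible_Int constructible_nonzero)
  qed
  show ?case
  proof (cases "0 \<in> set ps")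
    case True
    then obtain xs ys where ps: "ps = xs @ 0 # ys" by (meson split_list)
    have "constructible (solvable_params (xs @ ys) g)"
      by (intro less) (simp add: ps elim_weight_def)
    moreover have "solvable_params ps g = solvable_params (xs @ ys) g"
      by (auto simp: solvable_params_def ps)
    ultimately show ?thesis by simp
  next
    case False
    consider "ps = []" | p where "ps = [p]" | p q qs where "ps = p # q # qs"
      by (metis neq_Nil_conv)
    then show ?thesis
    proof cases
      case 1
      then show ?thesis by (simp add: solvable_params_Nil)
    next
      case 2
      with False have "p \<noteq> 0" by auto
      with 2 show ?thesis using split[OF reduct solvable_params_single] by simp
    next
      case 3
      have swap: "solvable_params (p # q # qs) g = solvable_params (q # p # qs) g"
        by (auto simp: solvable_params_def)
      show ?thesis
      proof (cases "degree p \<le> degree q")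
        case True
        then show ?thesis unfolding 3 using 3 False by (intro pair) auto
      next
        case False': False
        then show ?thesis unfolding 3 swap using 3 False by (intro pair) auto
      qed
    qed
  qed
qed

lemma constructible_projection:
  assumes "constructible S"
  shows "constructible {z. \<exists>x. z(v := x) \<in> S}"
proof -
  obtain Q where Q: "finite Q" "\<forall>(F, g)\<in>Q. finite F" "S = (\<Union>(F, g)\<in>Q. piece F g)"
    using assms unfolding constructible_def by blast
  have "constructible {z. \<exists>x. z(v := x) \<in> piece F g}" if "finite F" for F g
  proof -
    obtain u where u: "\<And>P z x. mpoly_eval (z(v := x)) P = poly (eval_coeffs z (u P)) x"
      using mpoly_as_univariate[of v] by metis
    obtain fs where fs: "set fs = F" using finite_list[OF \<open>finite F\<close>] by blast
    have "{z. \<exists>x. z(v := x) \<in> piece F g} = solvable_params (map u fs) (u g)"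
      by (auto simp: piece_def solvable_params_def u fs[symmetric])
    then show ?thesis by (simp add: constructible_solvable_params)
  qed
  moreover have "{z. \<exists>x. z(v := x) \<in> S} = (\<Union>(F, g)\<in>Q. {z. \<exists>x. z(v := x) \<in> piece F g})"
    unfolding Q(3) by auto
  ultimately show ?thesis using Q(1,2) by (auto intro!: constructible_UN)
qed

lemma constructible_projection_finite:
  assumes "finite V" "constructible S"
  shows "constructible {z. \<exists>y. (\<forall>v. v \<notin> V \<longrightarrow> y v = z v) \<and> y \<in> S}"
  using assms
proof (induction V rule: finite_induct)
  case empty
  have "{z. \<exists>y. (\<forall>v. v \<notin> {} \<longrightarrow> y v = z v) \<and> y \<in> S} = S"
    by (auto simp flip: fun_eq_iff)
  with empty show ?case by simp
next
  case (insert v V)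
  have "{z. \<exists>y. (\<forall>w. w \<notin> insert v V \<longrightarrow> y w = z w) \<and> y \<in> S}
      = {z. \<exists>x. z(v := x) \<in> {z. \<exists>y. (\<forall>w. w \<notin> V \<longrightarrow> y w = z w) \<and> y \<in> S}}"
  proof (intro set_eqI iffI)
    fix z assume "z \<in> {z. \<exists>y. (\<forall>w. w \<notin> insert v V \<longrightarrow> y w = z w) \<and> y \<in> S}"
    then obtain y where y: "\<forall>w. w \<notin> insert v V \<longrightarrow> y w = z w" "y \<in> S" by blast
    then show "z \<in> {z. \<exists>x. z(v := x) \<in> {z. \<exists>y. (\<forall>w. w \<notin> V \<longrightarrow> y w = z w) \<and> y \<in> S}}"
      by (auto intro!: exI[of _ "y v"] exI[of _ y])
  next
    fix z assume "z \<in> {z. \<exists>x. z(v := x) \<in> {z. \<exists>y. (\<forall>w. w \<notin> V \<longrightarrow> y w = z w) \<and> y \<in> S}}"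
    then obtain x y where y: "\<forall>w. w \<notin> V \<longrightarrow> y w = (z(v := x)) w" "y \<in> S" by blast
    then show "z \<in> {z. \<exists>y. (\<forall>w. w \<notin> insert v V \<longrightarrow> y w = z w) \<and> y \<in> S}"
      by (auto intro!: exI[of _ y])
  qed
  then show ?case using constructible_projection[OF insert.IH[OF insert.prems]] by simp
qed


section \<open>Images of polynomial maps\<close>

definition mpoly_subst :: "('v \<Rightarrow> 'w mpoly) \<Rightarrow> 'v mpoly \<Rightarrow> 'w mpoly" where
  "mpoly_subst \<sigma> P = (\<Sum>m\<in>Poly_Mapping.keys P. const (Poly_Mapping.lookup P m) *
     (\<Prod>v\<in>Poly_Mapping.keys m. \<sigma> v ^ Poly_Mapping.lookup m v))"

lemma mpoly_eval_const [simp]: "mpoly_eval x (const c) = c"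
  by (simp add: const_def mpoly_eval_simps)

lemma mpoly_eval_subst: "mpoly_eval x (mpoly_subst \<sigma> P) = mpoly_eval (\<lambda>v. mpoly_eval x (\<sigma> v)) P"
  by (simp add: mpoly_subst_def mpoly_eval_simps mpoly_eval_def[of _ P] mon_eval_def)

lemma mpoly_eval_cong:
  assumes "\<And>m v. m \<in> Poly_Mapping.keys P \<Longrightarrow> v \<in> Poly_Mapping.keys m \<Longrightarrow> x v = y v"
  shows "mpoly_eval x P = mpoly_eval y P"
  unfolding mpoly_eval_def mon_eval_def using assms
  by (intro sum.cong refl arg_cong2[of _ _ _ _ "(*)"] prod.cong) auto

lemma constructible_vimage:
  assumes "constructible T"
  shows "constructible {w. (\<lambda>u. mpoly_eval w (\<sigma> u)) \<in> T}"
proof -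
  obtain Q where Q: "finite Q" "\<forall>(F, g)\<in>Q. finite F" "T = (\<Union>(F, g)\<in>Q. piece F g)"
    using assms unfolding constructible_def by blast
  have "{w. (\<lambda>u. mpoly_eval w (\<sigma> u)) \<in> T}
      = (\<Union>(F, g)\<in>Q. piece (mpoly_subst \<sigma> ` F) (mpoly_subst \<sigma> g))"
    unfolding Q(3) piece_def by (auto simp: mpoly_eval_subst split_beta)
  then show ?thesis
    using Q(1,2) by (auto intro!: constructible_UN constructible_piece)
qed

text \<open>
  Chevalley's theorem for polynomial maps between affine spaces: the image is the projection of
  the graph. Target and source coordinates are placed side by side in a sum type, the finitely many
  source variables that occur are eliminated, and the remaining dummy source coordinates are
  set to zero.
\<close>

lemma constructible_image:
  fixes P :: "'m \<Rightarrow> 'v mpoly"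
  assumes "finite M"
  shows "constructible {w. \<exists>z. \<forall>m\<in>M. w m = mpoly_eval z (P m)}"
proof -
  define V where "V = (\<Union>m\<in>M. \<Union>a\<in>Poly_Mapping.keys (P m). Poly_Mapping.keys a)"
  have V: "finite V" using assms by (auto simp: V_def)
  define eqn :: "'m \<Rightarrow> ('m + 'v) mpoly"
    where "eqn m = var (Inl m) - mpoly_subst (\<lambda>v. var (Inr v)) (P m)" for m
  have eqn: "mpoly_eval y (eqn m) = y (Inl m) - mpoly_eval (\<lambda>v. y (Inr v)) (P m)" for y m
    by (simp add: eqn_def mpoly_eval_simps mpoly_eval_subst)
  define S where "S = (\<Inter>m\<in>M. {y. mpoly_eval y (eqn m) = 0})"
  define T where "T = {z. \<exists>y. (\<forall>u. u \<notin> Inr ` V \<longrightarrow> y u = z u) \<and> y \<in> S}"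
  have "constructible T"
    unfolding T_def S_def using assms V
    by (intro constructible_projection_finite constructible_INT constructible_zero) auto
  then have "constructible {w. (\<lambda>u. mpoly_eval w (case_sum var (\<lambda>_. 0) u)) \<in> T}"
    by (rule constructible_vimage)
  also have "{w. (\<lambda>u. mpoly_eval w (case_sum var (\<lambda>_. 0) u)) \<in> T}
      = {w. \<exists>z. \<forall>m\<in>M. w m = mpoly_eval z (P m)}"
  proof (intro set_eqI iffI)
    fix w :: "'m \<Rightarrow> complex" assume "w \<in> {w. (\<lambda>u. mpoly_eval w (case_sum var (\<lambda>_. 0) u)) \<in> T}"
    then obtain y where y: "\<forall>u. u \<notin> Inr ` V \<longrightarrow> y u = mpoly_eval w (case_sum var (\<lambda>_. 0) u)"
      "\<forall>m\<in>M. y (Inl m) = mpoly_eval (\<lambda>v. y (Inr v)) (P m)"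
      unfolding T_def S_def by (auto simp: eqn)
    have "y (Inl m) = w m" for m using y(1)[rule_format, of "Inl m"] by auto
    then show "w \<in> {w. \<exists>z. \<forall>m\<in>M. w m = mpoly_eval z (P m)}" using y(2) by auto
  next
    fix w :: "'m \<Rightarrow> complex" assume "w \<in> {w. \<exists>z. \<forall>m\<in>M. w m = mpoly_eval z (P m)}"
    then obtain z where z: "\<forall>m\<in>M. w m = mpoly_eval z (P m)" by blast
    define y where "y = case_sum w (\<lambda>v. if v \<in> V then z v else 0)"
    have "mpoly_eval (\<lambda>v. y (Inr v)) (P m) = mpoly_eval z (P m)" if "m \<in> M" for m
      using that by (intro mpoly_eval_cong) (auto simp: y_def V_def)
    then have "y \<in> S" using z by (auto simp: S_def eqn y_def)
    moreover have "y u = mpoly_eval w (case_sum var (\<lambda>_. 0) u)" if "u \<notin> Inr ` V" for u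
      using that by (cases u) (auto simp: y_def mpoly_eval_0)
    ultimately show "w \<in> {w. (\<lambda>u. mpoly_eval w (case_sum var (\<lambda>_. 0) u)) \<in> T}"
      unfolding T_def by blast
  qed
  finally show ?thesis .
qed


section \<open>Irreducibility of the space of forms\<close>

definition nonvanishing :: "nat \<Rightarrow> nat \<Rightarrow> nat monomial mpoly \<Rightarrow> nat mpoly set" where
  "nonvanishing n d h = {F \<in> forms n d. mpoly_eval (Poly_Mapping.lookup F) h \<noteq> 0}"

lemma lookup_const_mult: "Poly_Mapping.lookup (const c * F) m = c * Poly_Mapping.lookup F m"
  by (simp add: const_def mult_map_scale_conv_mult[symmetric] Poly_Mapping.map.rep_eq when_def)

lemma forms_add: "F \<in> forms n d \<Longrightarrow> G \<in> forms n d \<Longrightarrow> F + G \<in> forms n d"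
  using Poly_Mapping.keys_add[of F G] by (auto simp: forms_def)

lemma forms_const_mult: "F \<in> forms n d \<Longrightarrow> const c * F \<in> forms n d"
  by (auto simp: forms_def in_keys_iff lookup_const_mult)

lemma mpoly_eval_on_line:
  "\<exists>p. \<forall>t. mpoly_eval (\<lambda>v. x v + t * y v) P = poly p t"
proof -
  define p where "p = (\<Sum>m\<in>Poly_Mapping.keys P. smult (Poly_Mapping.lookup P m)
    (\<Prod>v\<in>Poly_Mapping.keys m. [:x v, y v:] ^ Poly_Mapping.lookup m v))"
  have "mpoly_eval (\<lambda>v. x v + t * y v) P = poly p t" for t
    by (simp add: p_def mpoly_eval_def mon_eval_def poly_sum poly_prod)
  then show ?thesis by blast
qed

text \<open>
  Irreducibility of affine space, on the line through a point where \<open>g\<close> does not vanish and one where \<open>h\<close>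
  does not: both polynomials restrict to nonzero univariate polynomials, and so does their product.
\<close>

lemma nonvanishing_mult:
  assumes "nonvanishing n d g \<noteq> {}" "nonvanishing n d h \<noteq> {}"
  shows "nonvanishing n d (g * h) \<noteq> {}"
proof -
  obtain F G where F: "F \<in> forms n d" "mpoly_eval (Poly_Mapping.lookup F) g \<noteq> 0"
    and G: "G \<in> forms n d" "mpoly_eval (Poly_Mapping.lookup G) h \<noteq> 0"
    using assms by (auto simp: nonvanishing_def)
  define L where "L t = F + const t * (G + const (-1) * F)" for t
  have L: "Poly_Mapping.lookup (L t)
      = (\<lambda>v. Poly_Mapping.lookup F v + t * (Poly_Mapping.lookup G v - Poly_Mapping.lookup F v))" for t
    by (rule ext) (simp add: L_def lookup_add lookup_const_mult)
  have L_forms: "L t \<in> forms n d" for t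
    unfolding L_def using F G by (intro forms_add forms_const_mult)
  obtain p q where p: "\<And>t. mpoly_eval (Poly_Mapping.lookup (L t)) g = poly p t"
    and q: "\<And>t. mpoly_eval (Poly_Mapping.lookup (L t)) h = poly q t"
    unfolding L using mpoly_eval_on_line by metis
  have "poly p 0 \<noteq> 0" using F p[of 0] unfolding L by simp
  moreover have "poly q 1 \<noteq> 0" using G q[of 1] unfolding L by simp
  ultimately have "p * q \<noteq> 0" by auto
  then obtain t where "poly (p * q) t \<noteq> 0" using poly_all_0_iff_0 by blast
  then have "L t \<in> nonvanishing n d (g * h)"
    using L_forms by (simp add: nonvanishing_def mpoly_eval_mult p q)
  then show ?thesis by blast
qed

lemma nonvanishing_mult_eq_Int: "nonvanishing n d (g * h) = nonvanishing n d g \<inter> nonvanishing n d h"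
  by (auto simp: nonvanishing_def mpoly_eval_mult)

lemma zero_in_forms: "0 \<in> forms n d"
  by (simp add: forms_def)

lemma nonvanishing_1: "nonvanishing n d 1 \<noteq> {}"
  using zero_in_forms by (auto simp: nonvanishing_def mpoly_eval_1)

lemma openin_nonvanishing: "openin (zariski n d) (nonvanishing n d h)"
  unfolding openin_zariski zariski_open_def nonvanishing_def by (intro exI[of _ "{h}"]) auto

lemma openin_zariski_nonvanishing:
  assumes "openin (zariski n d) U" "F \<in> U"
  obtains h where "F \<in> nonvanishing n d h" "nonvanishing n d h \<subseteq> U"
proof -
  obtain S where S: "U = forms n d - {F \<in> forms n d. \<forall>P\<in>S. mpoly_eval (Poly_Mapping.lookup F) P = 0}"
    using assms unfolding openin_zariski zariski_open_def by blast
  with assms obtain h where "h \<in> S" "F \<in> nonvanishing n d h" by (auto simp: nonvanishing_def)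
  moreover have "nonvanishing n d h \<subseteq> U" using \<open>h \<in> S\<close> by (auto simp: S nonvanishing_def)
  ultimately show thesis using that by blast
qed

lemma zariski_open_Int_nonempty:
  assumes "openin (zariski n d) U" "U \<noteq> {}" "openin (zariski n d) W" "W \<noteq> {}"
  shows "U \<inter> W \<noteq> {}"
proof -
  obtain g where "nonvanishing n d g \<noteq> {}" "nonvanishing n d g \<subseteq> U"
    using assms openin_zariski_nonvanishing by (metis empty_iff equals0I)
  moreover obtain h where "nonvanishing n d h \<noteq> {}" "nonvanishing n d h \<subseteq> W"
    using assms openin_zariski_nonvanishing by (metis empty_iff equals0I)
  ultimately show ?thesis using nonvanishing_mult[of n d g h] by (auto simp: nonvanishing_mult_eq_Int)
qed

lemma zariski_dense:
  assumes "openin (zariski n d) U" "U \<noteq> {}"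
  shows "zariski n d closure_of U = topspace (zariski n d)"
proof (rule antisym)
  show "topspace (zariski n d) \<subseteq> zariski n d closure_of U"
    using zariski_open_Int_nonempty[OF assms] by (force simp: in_closure_of)
qed (rule closure_of_subset_topspace)

text \<open>
  A piece \<open>F = 0 \<noteq> g\<close> is generic only if all equations in \<open>F\<close> are trivial on forms, and in that case
  it contains the open set where \<open>g\<close> does not vanish. Finitely many pieces that are not generic
  are avoided together by multiplying the polynomials that avoid each of them.
\<close>

lemma constructible_forms_dichotomy:
  assumes "constructible T"
  shows "(\<exists>g. nonvanishing n d g \<noteq> {} \<and> (\<forall>F\<in>nonvanishing n d g. Poly_Mapping.lookup F \<in> T)) \<or>
         (\<exists>h. nonvanishing n d h \<noteq> {} \<and> (\<forall>F\<in>nonvanishing n d h. Poly_Mapping.lookup F \<notin> T))"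
proof -
  obtain Q where Q: "finite Q" "T = (\<Union>(F, g)\<in>Q. piece F g)"
    using assms unfolding constructible_def by blast
  show ?thesis
    unfolding Q(2) using Q(1)
  proof (induction Q rule: finite_induct)
    case empty
    show ?case using nonvanishing_1 by blast
  next
    case (insert q Q)
    obtain E g where q: "q = (E, g)" by force
    show ?case
    proof (cases "nonvanishing n d g \<noteq> {} \<and> (\<forall>f\<in>E. nonvanishing n d f = {})")
      case True
      then have "\<forall>F\<in>nonvanishing n d g. Poly_Mapping.lookup F \<in> piece E g"
        by (auto simp: piece_def nonvanishing_def)
      then show ?thesis using True q by (auto intro!: exI[of _ g])
    next
      case False
      have "\<exists>h. nonvanishing n d h \<noteq> {} \<and> (\<forall>F\<in>nonvanishing n d h. Poly_Mapping.lookup F \<notin> piece E g)"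
      proof (cases "nonvanishing n d g = {}")
        case True
        then show ?thesis using nonvanishing_1
          by (intro exI[of _ 1]) (auto simp: piece_def nonvanishing_def)
      next
        case False': False
        then obtain f where "f \<in> E" "nonvanishing n d f \<noteq> {}" using False by blast
        then show ?thesis by (intro exI[of _ f]) (auto simp: piece_def nonvanishing_def)
      qed
      then obtain h where h: "nonvanishing n d h \<noteq> {}"
        "\<forall>F\<in>nonvanishing n d h. Poly_Mapping.lookup F \<notin> piece E g" by blast
      from insert.IH show ?thesis
      proof
        assume "\<exists>g. nonvanishing n d g \<noteq> {} \<and>
          (\<forall>F\<in>nonvanishing n d g. Poly_Mapping.lookup F \<in> (\<Union>(F, g)\<in>Q. piece F g))"
        then show ?thesis by (intro disjI1) auto
      next
        assume "\<exists>h. nonvanishing n d h \<noteq> {} \<and>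
          (\<forall>F\<in>nonvanishing n d h. Poly_Mapping.lookup F \<notin> (\<Union>(F, g)\<in>Q. piece F g))"
        then obtain h' where h': "nonvanishing n d h' \<noteq> {}"
          "\<forall>F\<in>nonvanishing n d h'. Poly_Mapping.lookup F \<notin> (\<Union>(F, g)\<in>Q. piece F g)" by blast
        show ?thesis
          using nonvanishing_mult[OF h(1) h'(1)] h(2) h'(2) q
          by (intro disjI2 exI[of _ "h * h'"]) (auto simp: nonvanishing_mult_eq_Int)
      qed
    qed
  qed
qed


section \<open>Monomials of bounded exponents\<close>

lemma mon_degree_superset:
  "finite A \<Longrightarrow> Poly_Mapping.keys m \<subseteq> A \<Longrightarrow> mon_degree m = (\<Sum>v\<in>A. Poly_Mapping.lookup m v)"
  unfolding mon_degree_def by (intro sum.mono_neutral_left) (auto simp: in_keys_iff)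

lemma mon_degree_add: "mon_degree (m + m') = mon_degree m + mon_degree m'"
proof -
  let ?A = "Poly_Mapping.keys m \<union> Poly_Mapping.keys m'"
  have "Poly_Mapping.keys (m + m') \<subseteq> ?A" by (rule Poly_Mapping.keys_add)
  then show ?thesis
    by (simp add: mon_degree_superset[of ?A] lookup_add sum.distrib)
qed

lemma mon_degree_single [simp]: "mon_degree (Poly_Mapping.single v k) = k"
  by (simp add: mon_degree_superset[of "{v}"])

lemma mon_degree_eq_0_iff: "mon_degree m = 0 \<longleftrightarrow> m = 0"
  by (auto simp: mon_degree_def in_keys_iff intro: poly_mapping_eqI)

lemma monomials_0: "monomials n 0 = {0}"
  by (auto simp: monomials_def mon_degree_eq_0_iff)

lemma monomials_SucE:
  assumes "m \<in> monomials n (Suc d)"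
  obtains v m' where "v < n" "m' \<in> monomials n d" "m = Poly_Mapping.single v 1 + m'"
proof -
  from assms have m: "Poly_Mapping.keys m \<subseteq> {..<n}" "mon_degree m = Suc d"
    by (auto simp: monomials_def)
  then have "m \<noteq> 0" using mon_degree_eq_0_iff[of m] by auto
  then obtain v where v: "v \<in> Poly_Mapping.keys m" by (metis all_not_in_conv keys_eq_empty)
  define m' where "m' = m - Poly_Mapping.single v 1"
  have eq: "m = Poly_Mapping.single v 1 + m'"
    using v by (intro poly_mapping_eqI)
      (auto simp: m'_def lookup_add lookup_minus lookup_single when_def in_keys_iff)
  have "mon_degree m' = d" using m(2) unfolding eq mon_degree_add by simp
  moreover have "Poly_Mapping.keys m' \<subseteq> {..<n}"
    using m(1) by (auto simp: m'_def in_keys_iff lookup_minus subset_iff)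
  ultimately show thesis using that[of v m'] v m(1) eq by (auto simp: monomials_def)
qed

lemma monomials_1: "monomials n 1 = (\<lambda>v. Poly_Mapping.single v 1) ` {..<n}"
proof (intro set_eqI iffI)
  fix m assume "m \<in> monomials n 1"
  then have "m \<in> monomials n (Suc 0)" by simp
  then show "m \<in> (\<lambda>v. Poly_Mapping.single v 1) ` {..<n}"
    by (rule monomials_SucE) (auto simp: monomials_0)
qed (auto simp: monomials_def)

lemma monomial_eq_prod_list:
  "m \<in> monomials n d \<Longrightarrow>
    \<exists>as. length as = d \<and> set as \<subseteq> forms n 1 \<and> Poly_Mapping.single m (1::complex) = prod_list as"
proof (induction d arbitrary: m)
  case 0
  then show ?case by (simp add: monomials_0)
next
  case (Suc d)
  from Suc.prems obtain v m' where v: "v < n" "m' \<in> monomials n d" "m = Poly_Mapping.single v 1 + m'"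
    by (rule monomials_SucE)
  with Suc.IH obtain as where "length as = d" "set as \<subseteq> forms n 1"
    "Poly_Mapping.single m' (1::complex) = prod_list as" by blast
  moreover have "Poly_Mapping.single m (1::complex)
      = Poly_Mapping.single (Poly_Mapping.single v 1) 1 * Poly_Mapping.single m' 1"
    by (simp add: v mult_single)
  moreover have "Poly_Mapping.single (Poly_Mapping.single v 1) 1 \<in> forms n 1"
    using v(1) by (simp add: forms_def monomials_1 del: One_nat_def)
  ultimately show ?case
    by (intro exI[of _ "Poly_Mapping.single (Poly_Mapping.single v 1) 1 # as"]) auto
qed

definition exponent_box :: "'v set \<Rightarrow> nat \<Rightarrow> 'v monomial set" where
  "exponent_box V k = {m. Poly_Mapping.keys m \<subseteq> V \<and> (\<forall>v. Poly_Mapping.lookup m v \<le> k)}"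

lemma
  assumes "finite V"
  shows card_exponent_box: "card (exponent_box V k) = (k + 1) ^ card V" 
    and finite_exponent_box: "finite (exponent_box V k)"
proof -
  have "bij_betw (\<lambda>m. restrict (Poly_Mapping.lookup m) V) (exponent_box V k) (PiE V (\<lambda>_. {..k}))"
  proof (rule bij_betw_byWitness[where f' = "\<lambda>f. Abs_poly_mapping (\<lambda>v. if v \<in> V then f v else 0)"])
    have [simp]: "Poly_Mapping.lookup (Abs_poly_mapping (\<lambda>v. if v \<in> V then f v else 0))
        = (\<lambda>v. if v \<in> V then f v else 0)" for f :: "'a \<Rightarrow> nat"
      using assms by (intro lookup_Abs_poly_mapping) (auto intro: finite_subset)
    show "\<forall>m\<in>exponent_box V k. Abs_poly_mapping (\<lambda>v. if v \<in> V then restrict (Poly_Mapping.lookup m) V v else 0) = m"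
      by (auto simp: exponent_box_def in_keys_iff intro!: poly_mapping_eqI)
    show "\<forall>f\<in>PiE V (\<lambda>_. {..k}). restrict (Poly_Mapping.lookup
        (Abs_poly_mapping (\<lambda>v. if v \<in> V then f v else 0))) V = f"
      by (auto simp: restrict_def PiE_def extensional_def)
    show "(\<lambda>m. restrict (Poly_Mapping.lookup m) V) ` exponent_box V k \<subseteq> PiE V (\<lambda>_. {..k})"
      by (auto simp: exponent_box_def)
    show "(\<lambda>f. Abs_poly_mapping (\<lambda>v. if v \<in> V then f v else 0)) ` PiE V (\<lambda>_. {..k}) \<subseteq> exponent_box V k"
      by (auto simp: exponent_box_def in_keys_iff split: if_splits)
  qed
  from bij_betw_same_card[OF this] bij_betw_finite[OF this] assms
  show "card (exponent_box V k) = (k + 1) ^ card V" "finite (exponent_box V k)"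
    by (auto simp: card_PiE finite_PiE)
qed

lemma monomials_subset_exponent_box: "monomials n d \<subseteq> exponent_box {..<n} d"
proof
  fix m assume m: "m \<in> monomials n d"
  have "Poly_Mapping.lookup m v \<le> d" for v
  proof (cases "v \<in> Poly_Mapping.keys m")
    case True
    then show ?thesis using m member_le_sum[of v "Poly_Mapping.keys m" "Poly_Mapping.lookup m"]
      by (auto simp: monomials_def mon_degree_def)
  qed (simp add: in_keys_iff)
  then show "m \<in> exponent_box {..<n} d" using m by (auto simp: exponent_box_def monomials_def)
qed

lemma finite_monomials: "finite (monomials n d)"
  using monomials_subset_exponent_box finite_exponent_box by (rule finite_subset) simp


text \<open>
  The binomial coefficient counts the squarefree monomials.
\<close>

lemma card_monomials_ge: "n choose d \<le> card (monomials n d)"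
proof -
  define f where "f S = (\<Sum>v\<in>S. Poly_Mapping.single v (1::nat))" for S :: "nat set"
  have lookup: "Poly_Mapping.lookup (f S) v = (if v \<in> S then 1 else 0)" if "finite S" for S v
    using that by (simp add: f_def lookup_sum lookup_single when_def)
  have keys: "Poly_Mapping.keys (f S) = S" if "finite S" for S
    using lookup[OF that] by (auto simp: in_keys_iff split: if_splits)
  let ?A = "{S. S \<subseteq> {..<n} \<and> card S = d}"
  have fin: "finite S" if "S \<in> ?A" for S using that finite_subset by blast
  have "inj_on f ?A"
    by (rule inj_onI) (metis fin keys)
  moreover have "f ` ?A \<subseteq> monomials n d"
  proof (rule image_subsetI)
    fix S assume S: "S \<in> ?A"
    then have "mon_degree (f S) = d"
      using fin[OF S] by (simp add: mon_degree_def keys lookup)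
    with S fin[OF S] show "f S \<in> monomials n d" by (simp add: monomials_def keys)
  qed
  ultimately have "card ?A \<le> card (monomials n d)"
    using finite_monomials by (intro card_inj_on_le)
  then show ?thesis using n_subsets[of "{..<n}" d] by simp
qed


section \<open>Sums of powers of linear forms\<close>

definition power_sum :: "nat \<Rightarrow> nat \<Rightarrow> nat \<Rightarrow> nat mpoly \<Rightarrow> bool" where
  "power_sum n d r F \<longleftrightarrow> (\<exists>(c :: nat \<Rightarrow> complex) (l :: nat \<Rightarrow> nat mpoly).
        (\<forall>i<r. l i \<in> forms n 1) \<and> F = (\<Sum>i<r. const (c i) * l i ^ d))"

lemma waring_rank_eq: "waring_rank n d F = (LEAST r. power_sum n d r F)"
  by (simp add: waring_rank_def power_sum_def)

lemma waring_rank_le: "power_sum n d r F \<Longrightarrow> waring_rank n d F \<le> r"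
  unfolding waring_rank_eq by (rule Least_le)

lemma const_0 [simp]: "const 0 = 0"
  by (simp add: const_def)

lemma const_1 [simp]: "const 1 = 1"
  by (simp add: const_def)

lemma const_mult: "const (a * b) = const a * const b"
  by (simp add: const_def mult_single)

lemma const_uminus: "const (- a) = - const a"
  by (simp add: const_def single_uminus)

lemma power_sum_0: "power_sum n d 0 0"
  by (auto simp: power_sum_def)

lemma power_sum_add:
  assumes "power_sum n d r F" "power_sum n d s G"
  shows "power_sum n d (r + s) (F + G)"
proof -
  obtain c l c' l' where l: "\<forall>i<r. l i \<in> forms n 1" "F = (\<Sum>i<r. const (c i) * l i ^ d)"
    and l': "\<forall>i<s. l' i \<in> forms n 1" "G = (\<Sum>i<s. const (c' i) * l' i ^ d)"
    using assms unfolding power_sum_def by blast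
  define c'' where "c'' i = (if i < r then c i else c' (i - r))" for i
  define l'' where "l'' i = (if i < r then l i else l' (i - r))" for i
  have "(\<Sum>i<r + s. const (c'' i) * l'' i ^ d)
      = (\<Sum>i<r. const (c'' i) * l'' i ^ d) + (\<Sum>i\<in>{r..<r+s}. const (c'' i) * l'' i ^ d)"
    by (subst sum.union_disjoint[symmetric]) (auto intro!: sum.cong)
  also have "(\<Sum>i<r. const (c'' i) * l'' i ^ d) = F"
    by (simp add: l c''_def l''_def)
  also have "(\<Sum>i\<in>{r..<r+s}. const (c'' i) * l'' i ^ d) = G"
    unfolding l' by (rule sum.reindex_bij_witness[of _ "\<lambda>i. i + r" "\<lambda>i. i - r"])
      (auto simp: c''_def l''_def)
  finally have "F + G = (\<Sum>i<r + s. const (c'' i) * l'' i ^ d)" by simp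
  moreover have "\<forall>i<r+s. l'' i \<in> forms n 1" using l l' by (auto simp: l''_def)
  ultimately show ?thesis unfolding power_sum_def by blast
qed

lemma power_sum_const_mult:
  assumes "power_sum n d r F"
  shows "power_sum n d r (const a * F)"
proof -
  obtain c l where l: "\<forall>i<r. l i \<in> forms n 1" "F = (\<Sum>i<r. const (c i) * l i ^ d)"
    using assms unfolding power_sum_def by blast
  then have "const a * F = (\<Sum>i<r. const (a * c i) * l i ^ d)"
    by (simp add: sum_distrib_left const_mult mult.assoc)
  then show ?thesis
    using l(1) unfolding power_sum_def by (intro exI[of _ "\<lambda>i. a * c i"] exI[of _ l]) blast
qed

lemma power_sum_sum:
  "finite I \<Longrightarrow> (\<And>i. i \<in> I \<Longrightarrow> power_sum n d r (F i)) \<Longrightarrow> power_sum n d (card I * r) (\<Sum>i\<in>I. F i)"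
  by (induction I rule: finite_induct) (auto simp: power_sum_0 intro: power_sum_add)

lemma power_sum_power: "l \<in> forms n 1 \<Longrightarrow> power_sum n d 1 (l ^ d)"
  unfolding power_sum_def by (intro exI[of _ "\<lambda>_. 1"] exI[of _ "\<lambda>_. l"]) simp

lemma power_sum_mono:
  assumes "power_sum n d r F" "r \<le> s"
  shows "power_sum n d s F"
proof -
  have "power_sum n d 1 0"
    unfolding power_sum_def
    by (intro exI[of _ "\<lambda>_. 0"] exI[of _ "\<lambda>_. 0"]) (auto simp: forms_def)
  then have "power_sum n d (card {..<s - r} * 1) (\<Sum>i<s - r. 0)"
    by (intro power_sum_sum) auto
  from power_sum_add[OF assms(1) this] assms(2) show ?thesis by simp
qed


section \<open>Polarization\<close>

text \<open>
  The recursion applies the first difference last. This makes the number \<open>2 ^ k\<close> of terms of the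
  \<open>k\<close>-fold difference evident by induction.
\<close>

fun iterated_difference :: "'a::comm_ring_1 list \<Rightarrow> ('a \<Rightarrow> 'a) \<Rightarrow> 'a \<Rightarrow> 'a" where
  "iterated_difference [] g y = g y"
| "iterated_difference (a # as) g y
    = iterated_difference as g (y + a) - iterated_difference as g y"

lemma iterated_difference_shift:
  "iterated_difference (a # as) g y = iterated_difference as (\<lambda>y. g (y + a) - g y) y"
proof (induction as arbitrary: y)
  case (Cons b as)
  have "iterated_difference (b # as) (\<lambda>y. g (y + a) - g y) y
      = iterated_difference (a # as) g (y + b) - iterated_difference (a # as) g y"
    using Cons[of "y + b"] Cons[of y] by simp
  then show ?case by (simp add: algebra_simps)
qed simp

lemma iterated_difference_sum:
  "iterated_difference as (\<lambda>y. \<Sum>i\<in>I. c i * g i y) y = (\<Sum>i\<in>I. c i * iterated_difference as (g i) y)"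
  by (induction as arbitrary: y) (simp_all add: sum_subtractf algebra_simps)

text \<open>
  A difference with step \<open>a\<close> turns \<open>y ^ j\<close> into \<open>j * a * y ^ (j - 1)\<close> plus lower powers, so \<open>k\<close>
  differences kill all powers below \<open>k\<close> and turn \<open>y ^ k\<close> into a constant. The first difference has to
  be moved inside before the binomial theorem applies.
\<close>

lemma iterated_difference_power:
  fixes as :: "'a::comm_ring_1 list"
  assumes "j \<le> length as"
  shows "iterated_difference as (\<lambda>y. y ^ j) y = (if j = length as then of_nat (fact j) * prod_list as else 0)"
  using assms
proof (induction as arbitrary: j y)
  case (Cons a as)
  have "(y + a) ^ j - y ^ j = (\<Sum>i<j. (of_nat (j choose i) * a ^ (j - i)) * y ^ i)" for y
  proof -
    have "(y + a) ^ j = (\<Sum>i\<le>j. (of_nat (j choose i) * a ^ (j - i)) * y ^ i)"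
      by (subst binomial_ring) (simp add: mult_ac)
    also have "{..j} = insert j {..<j}" by auto
    finally show ?thesis by simp
  qed
  then have "iterated_difference (a # as) (\<lambda>y. y ^ j) y
      = (\<Sum>i<j. (of_nat (j choose i) * a ^ (j - i)) * iterated_difference as (\<lambda>y. y ^ i) y)"
    by (simp only: iterated_difference_shift iterated_difference_sum)
  also have "\<dots> = (\<Sum>i<j. if i = length as
      then (of_nat (j choose i) * a ^ (j - i)) * (of_nat (fact i) * prod_list as) else 0)"
    using Cons.prems by (intro sum.cong refl) (auto simp: Cons.IH)
  also have "\<dots> = (if j = length (a # as) then of_nat (fact j) * prod_list (a # as) else 0)"
    using Cons.prems by (auto simp: sum.delta algebra_simps)
  finally show ?case .
qed simp

lemma power_sum_iterated_difference:
  "y \<in> forms n 1 \<Longrightarrow> set as \<subseteq> forms n 1 \<Longrightarrow>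
    power_sum n d (2 ^ length as) (iterated_difference as (\<lambda>y. y ^ d) y)"
proof (induction as arbitrary: y)
  case Nil
  then show ?case using power_sum_power by simp
next
  case (Cons a as)
  then have "power_sum n d (2 ^ length as) (iterated_difference as (\<lambda>y. y ^ d) (y + a))"
    and "power_sum n d (2 ^ length as) (const (-1) * iterated_difference as (\<lambda>y. y ^ d) y)"
    by (auto intro: power_sum_const_mult forms_add)
  from power_sum_add[OF this] show ?case by (simp add: const_uminus mult_2)
qed

text \<open>
  Polarization: the \<open>d\<close>-fold difference of \<open>y ^ d\<close> at \<open>0\<close> is \<open>d!\<close> times the product, and it is a signed
  sum of \<open>2 ^ d\<close> many \<open>d\<close>-th powers.
\<close>

lemma power_sum_prod_list:
  assumes "set as \<subseteq> forms n 1"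
  shows "power_sum n (length as) (2 ^ length as) (prod_list as)"
proof -
  let ?d = "length as"
  have "const (1 / of_nat (fact ?d)) * of_nat (fact ?d) = (1 :: nat mpoly)"
    by (simp add: const_def mult_single del: of_nat_fact flip: single_of_nat)
  then have "prod_list as = const (1 / of_nat (fact ?d)) * iterated_difference as (\<lambda>y. y ^ ?d) 0"
    by (simp add: iterated_difference_power mult.assoc[symmetric] del: of_nat_fact)
  then show ?thesis
    using power_sum_const_mult[OF power_sum_iterated_difference[OF _ assms, of 0]]
    by (simp add: forms_def)
qed

lemma power_sum_monomial:
  assumes "m \<in> monomials n d"
  shows "power_sum n d (2 ^ d) (Poly_Mapping.single m 1)"
  using monomial_eq_prod_list[OF assms] power_sum_prod_list by metis

lemma power_sum_forms:
  assumes "F \<in> forms n d"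
  shows "power_sum n d (card (Poly_Mapping.keys F) * 2 ^ d) F"
proof -
  have "power_sum n d (2 ^ d) (Poly_Mapping.single m (Poly_Mapping.lookup F m))"
    if "m \<in> Poly_Mapping.keys F" for m
  proof -
    have "m \<in> monomials n d" using that assms by (auto simp: forms_def)
    from power_sum_const_mult[OF power_sum_monomial[OF this], of "Poly_Mapping.lookup F m"]
    show ?thesis by (simp add: const_def mult_single)
  qed
  then have "power_sum n d (card (Poly_Mapping.keys F) * 2 ^ d)
      (\<Sum>m\<in>Poly_Mapping.keys F. Poly_Mapping.single m (Poly_Mapping.lookup F m))"
    by (intro power_sum_sum[OF finite_keys])
  then show ?thesis
    by (simp only: sum_single_lookup)
qed


section \<open>The rank of sums of coprime monomials\<close>

text \<open>
  As \<open>d\<close> is positive, each monomial owns a variable, which it shares with no other monomial.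
\<close>

lemma coprime_family_size:
  assumes "d \<ge> 1" "\<forall>i<t. M i \<in> monomials n d"
    and disj: "\<forall>i<t. \<forall>j<t. i \<noteq> j \<longrightarrow> Poly_Mapping.keys (M i) \<inter> Poly_Mapping.keys (M j) = {}"
  shows "t \<le> n"
proof -
  have "\<exists>v. v \<in> Poly_Mapping.keys (M i)" if "i < t" for i
  proof -
    have "M i \<noteq> 0" using assms that mon_degree_eq_0_iff[of "M i"] by (force simp: monomials_def)
    then show ?thesis by (metis all_not_in_conv keys_eq_empty)
  qed
  then have "\<forall>i\<in>{..<t}. \<exists>v. v \<in> Poly_Mapping.keys (M i)" by blast
  from bchoice[OF this] obtain v where v: "\<forall>i\<in>{..<t}. v i \<in> Poly_Mapping.keys (M i)"
    by (rule exE)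
  have "inj_on v {..<t}"
  proof (rule inj_onI)
    fix i j assume "i \<in> {..<t}" "j \<in> {..<t}" "v i = v j"
    moreover from this have "v i \<in> Poly_Mapping.keys (M i) \<inter> Poly_Mapping.keys (M j)"
      using v by (metis IntI)
    ultimately show "i = j" using disj by (metis empty_iff lessThan_iff)
  qed
  moreover have "v ` {..<t} \<subseteq> {..<n}" using v assms(2) by (fastforce simp: monomials_def)
  ultimately have "card {..<t} \<le> card {..<n}" by (intro card_inj_on_le) auto
  then show ?thesis by simp
qed

lemma max_coprime_waring_rank_le:
  assumes "d \<ge> 1" "n \<ge> 1"
  shows "max_coprime_waring_rank n d \<le> n * 2 ^ d"
proof -
  have le: "waring_rank n d F \<le> n * 2 ^ d" if "F \<in> coprime_monomial_sums n d" for F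
  proof -
    from that obtain t :: nat and M where F: "F = (\<Sum>i<t. Poly_Mapping.single (M i) 1)" 
      and M: "\<forall>i<t. M i \<in> monomials n d"
      and disj: "\<forall>i<t. \<forall>j<t. i \<noteq> j \<longrightarrow> Poly_Mapping.keys (M i) \<inter> Poly_Mapping.keys (M j) = {}"
      unfolding coprime_monomial_sums_def mem_Collect_eq by blast
    have "power_sum n d (card {..<t} * 2 ^ d) F"
      unfolding F by (rule power_sum_sum) (use M power_sum_monomial in auto)
    then have "waring_rank n d F \<le> t * 2 ^ d"
      using waring_rank_le by simp
    also have "\<dots> \<le> n * 2 ^ d"
      using coprime_family_size[OF assms(1) M disj] by simp
    finally show ?thesis .
  qed
  \<comment> \<open>\<open>Max\<close> is meaningful only for a nonempty finite set; finiteness follows from the bound itself.\<close>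
  have "Poly_Mapping.single (Poly_Mapping.single 0 d) 1 \<in> coprime_monomial_sums n d"
    unfolding coprime_monomial_sums_def mem_Collect_eq
    by (rule exI[of _ "1::nat"], rule exI[of _ "\<lambda>_. Poly_Mapping.single 0 d"])
      (use assms in \<open>simp add: monomials_def\<close>)
  moreover have "finite (waring_rank n d ` coprime_monomial_sums n d)"
    by (rule finite_subset[of _ "{..n * 2 ^ d}"]) (use le in auto)
  ultimately show ?thesis
    unfolding max_coprime_waring_rank_def using le by (subst Max_le_iff) auto
qed


section \<open>Algebraic dependence of polynomials in few variables\<close>

text \<open>
  Gaussian elimination: one equation is used to eliminate one unknown.
\<close>

lemma homogeneous_system_nontrivial:
  fixes a :: "'i \<Rightarrow> 'b \<Rightarrow> 'f::field"
  assumes "finite B" "finite I" "card B < card I"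
  shows "\<exists>c. (\<exists>i\<in>I. c i \<noteq> 0) \<and> (\<forall>b\<in>B. (\<Sum>i\<in>I. c i * a i b) = 0)"
  using assms
proof (induction B arbitrary: I a rule: finite_induct)
  case empty
  then have "I \<noteq> {}" by auto
  then show ?case by (intro exI[of _ "\<lambda>_. 1"]) auto
next
  case (insert b B)
  show ?case
  proof (cases "\<forall>i\<in>I. a i b = 0")
    case True
    obtain c where "\<exists>i\<in>I. c i \<noteq> 0" "\<forall>b\<in>B. (\<Sum>i\<in>I. c i * a i b) = 0"
      using insert.IH[of I a] insert.prems insert.hyps by auto
    with True show ?thesis by (intro exI[of _ c]) auto
  next
    case False
    then obtain j where j: "j \<in> I" "a j b \<noteq> 0" by blast
    define I' where "I' = I - {j}"
    define a' where "a' i b' = a i b' - a i b / a j b * a j b'" for i b'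
    have I': "finite I'" "card B < card I'" and I: "I = insert j I'" "j \<notin> I'"
      using insert.prems insert.hyps j by (auto simp: I'_def)
    obtain c where c: "\<exists>i\<in>I'. c i \<noteq> 0" "\<forall>b\<in>B. (\<Sum>i\<in>I'. c i * a' i b) = 0"
      using insert.IH[OF I', of a'] by blast
    define c' where "c' i = (if i = j then - (\<Sum>i\<in>I'. c i * a i b) / a j b else c i)" for i
    have eq: "(\<Sum>i\<in>I. c' i * a i b') = (\<Sum>i\<in>I'. c i * a' i b')" for b'
    proof -
      have "(\<Sum>i\<in>I. c' i * a i b') = c' j * a j b' + (\<Sum>i\<in>I'. c' i * a i b')"
        unfolding I(1) using I' I(2) by simp
      also have "(\<Sum>i\<in>I'. c' i * a i b') = (\<Sum>i\<in>I'. c i * a i b')"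
        using I(2) by (intro sum.cong) (auto simp: c'_def)
      also have "c' j * a j b' = - ((\<Sum>i\<in>I'. c i * a i b) * (a j b' / a j b))"
        by (simp add: c'_def)
      also have "\<dots> = - (\<Sum>i\<in>I'. c i * (a i b / a j b * a j b'))"
        unfolding sum_distrib_right by (intro arg_cong[of _ _ uminus] sum.cong refl) simp
      finally show ?thesis
        by (simp add: a'_def right_diff_distrib sum_subtractf)
    qed
    have "a' i b = 0" for i using j by (simp add: a'_def)
    then have "\<forall>b'\<in>insert b B. (\<Sum>i\<in>I. c' i * a i b') = 0" using c(2) eq by simp
    moreover have "\<exists>i\<in>I. c' i \<noteq> 0" using c(1) I by (auto simp: c'_def)
    ultimately show ?thesis by blast
  qed
qed

lemma exponent_box_mono: "k \<le> l \<Longrightarrow> exponent_box V k \<subseteq> exponent_box V l"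
  by (auto simp: exponent_box_def intro: order_trans)

lemma keys_mult_exponent_box:
  assumes "Poly_Mapping.keys P \<subseteq> exponent_box V k" "Poly_Mapping.keys Q \<subseteq> exponent_box V l"
  shows "Poly_Mapping.keys (P * Q) \<subseteq> exponent_box V (k + l)"
proof
  fix m assume "m \<in> Poly_Mapping.keys (P * Q)"
  then obtain a b where m: "m = a + b" "a \<in> Poly_Mapping.keys P" "b \<in> Poly_Mapping.keys Q"
    using Poly_Mapping.keys_mult by blast
  then have "a \<in> exponent_box V k" "b \<in> exponent_box V l" using assms by auto
  then show "m \<in> exponent_box V (k + l)"
    using Poly_Mapping.keys_add[of a b] by (auto simp: m(1) exponent_box_def lookup_add intro: add_mono)
qed

lemma keys_1_exponent_box: "Poly_Mapping.keys (1 :: 'v mpoly) \<subseteq> exponent_box V k"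
  by (simp add: exponent_box_def)

lemma keys_power_exponent_box:
  assumes "Poly_Mapping.keys P \<subseteq> exponent_box V k"
  shows "Poly_Mapping.keys (P ^ e) \<subseteq> exponent_box V (e * k)"
proof (induction e)
  case (Suc e)
  show ?case using keys_mult_exponent_box[OF assms Suc] by (simp add: mult.commute)
qed (use keys_1_exponent_box in simp)

lemma keys_prod_exponent_box:
  assumes "finite M" "\<And>m. m \<in> M \<Longrightarrow> Poly_Mapping.keys (P m) \<subseteq> exponent_box V k"
  shows "Poly_Mapping.keys (\<Prod>m\<in>M. P m) \<subseteq> exponent_box V (card M * k)"
  using assms
proof (induction M rule: finite_induct)
  case (insert m M)
  then show ?case using keys_mult_exponent_box[of "P m" V k "\<Prod>m\<in>M. P m" "card M * k"] by simp
qed (use keys_1_exponent_box in simp)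

text \<open>
  The dimension count. With \<open>p\<close> the number of source variables and \<open>N > p\<close> target coordinates, there are
  \<open>(E + 1) ^ N\<close> monomials in the \<open>P m\<close> with exponents up to \<open>E\<close>, and they all lie in a space spanned by
  \<open>(c E + 1) ^ p\<close> monomials of the source, where \<open>c\<close> does not depend on \<open>E\<close>. The former number grows with a
  larger power of \<open>E\<close>, so for large \<open>E\<close> they are linearly dependent.
\<close>

lemma algebraic_dependence:
  fixes P :: "'m \<Rightarrow> 'v mpoly"
  assumes M: "finite M" and V: "finite V" "card V < card M"
    and P: "\<And>m. m \<in> M \<Longrightarrow> Poly_Mapping.keys (P m) \<subseteq> exponent_box V k"
  obtains H :: "'m mpoly"
  where "H \<noteq> 0" "\<And>a. a \<in> Poly_Mapping.keys H \<Longrightarrow> Poly_Mapping.keys a \<subseteq> M"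
    "\<And>z w. (\<And>m. m \<in> M \<Longrightarrow> w m = mpoly_eval z (P m)) \<Longrightarrow> mpoly_eval w H = 0"
proof -
  define c where "c = card M * k"
  \<comment> \<open>Any \<open>E \<ge> (c + 1) ^ p\<close> works, as \<open>(c E + 1) ^ p \<le> (c + 1) ^ p * (E + 1) ^ p < (E + 1) ^ (p + 1)\<close>.\<close>
  define E where "E = (c + 1) ^ card V"
  define I where "I = exponent_box M E"
  define B where "B = exponent_box V (c * E)"
  define Q where "Q \<alpha> = (\<Prod>m\<in>M. P m ^ Poly_Mapping.lookup \<alpha> m)" for \<alpha>
  have "card B = (c * E + 1) ^ card V" using V by (simp add: B_def card_exponent_box)
  also have "\<dots> \<le> ((c + 1) * (E + 1)) ^ card V" by (intro power_mono) auto
  also have "\<dots> = E * (E + 1) ^ card V" by (simp only: power_mult_distrib E_def)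
  also have "\<dots> < (E + 1) * (E + 1) ^ card V" by simp
  also have "\<dots> = (E + 1) ^ Suc (card V)" by simp
  also have "\<dots> \<le> (E + 1) ^ card M" using V by (intro power_increasing) auto
  also have "\<dots> = card I" using M by (simp add: I_def card_exponent_box)
  finally have "card B < card I" .
  moreover have fin: "finite B" "finite I" using M V by (auto simp: B_def I_def finite_exponent_box)
  ultimately obtain u where u: "\<exists>\<alpha>\<in>I. u \<alpha> \<noteq> 0"
    "\<forall>b\<in>B. (\<Sum>\<alpha>\<in>I. u \<alpha> * Poly_Mapping.lookup (Q \<alpha>) b) = 0"
    using homogeneous_system_nontrivial[of B I "\<lambda>\<alpha>. Poly_Mapping.lookup (Q \<alpha>)"] by blast
  have Q_keys: "Poly_Mapping.keys (Q \<alpha>) \<subseteq> B" if "\<alpha> \<in> I" for \<alpha>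
  proof -
    have "Poly_Mapping.keys (P m ^ Poly_Mapping.lookup \<alpha> m) \<subseteq> exponent_box V (E * k)" if "m \<in> M" for m
      using keys_power_exponent_box[OF P[OF that], of "Poly_Mapping.lookup \<alpha> m"]
        exponent_box_mono[of "Poly_Mapping.lookup \<alpha> m * k" "E * k" V] \<open>\<alpha> \<in> I\<close> by (auto simp: I_def exponent_box_def)
    from keys_prod_exponent_box[OF M this] show ?thesis by (simp add: Q_def B_def c_def mult_ac)
  qed
  have rel: "(\<Sum>\<alpha>\<in>I. const (u \<alpha>) * Q \<alpha>) = 0"
  proof (rule poly_mapping_eqI)
    fix b
    have "(\<Sum>\<alpha>\<in>I. u \<alpha> * Poly_Mapping.lookup (Q \<alpha>) b) = 0"
    proof (cases "b \<in> B")
      case False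
      then have "Poly_Mapping.lookup (Q \<alpha>) b = 0" if "\<alpha> \<in> I" for \<alpha>
        using Q_keys[OF that] by (auto simp: in_keys_iff)
      then show ?thesis by simp
    qed (use u in blast)
    then show "Poly_Mapping.lookup (\<Sum>\<alpha>\<in>I. const (u \<alpha>) * Q \<alpha>) b = Poly_Mapping.lookup 0 b"
      by (simp add: lookup_sum lookup_const_mult)
  qed
  define H where "H = (\<Sum>\<alpha>\<in>I. Poly_Mapping.single \<alpha> (u \<alpha>))"
  have H: "Poly_Mapping.lookup H \<alpha> = (if \<alpha> \<in> I then u \<alpha> else 0)" for \<alpha>
    using fin by (simp add: H_def lookup_sum lookup_single when_def)
  show thesis
  proof
    show "H \<noteq> 0" using u(1) H by (metis lookup_zero)
    show "Poly_Mapping.keys a \<subseteq> M" if "a \<in> Poly_Mapping.keys H" for a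
      using that by (auto simp: in_keys_iff H I_def exponent_box_def split: if_splits)
    fix z w assume w: "\<And>m. m \<in> M \<Longrightarrow> w m = mpoly_eval z (P m)"
    have "mon_eval w \<alpha> = mpoly_eval z (Q \<alpha>)" if "\<alpha> \<in> I" for \<alpha>
    proof -
      have "Poly_Mapping.keys \<alpha> \<subseteq> M" using that by (simp add: I_def exponent_box_def)
      from mon_eval_superset[OF M this] show ?thesis
        by (simp add: Q_def mpoly_eval_simps w)
    qed
    then have "mpoly_eval w H = mpoly_eval z (\<Sum>\<alpha>\<in>I. const (u \<alpha>) * Q \<alpha>)"
      by (simp add: H_def mpoly_eval_simps)
    then show "mpoly_eval w H = 0" by (simp add: rel mpoly_eval_0)
  qed
qed

lemma mon_eval_scale_coordinate:
  "mon_eval (z(v := 2 * z v)) m = 2 ^ Poly_Mapping.lookup m v * mon_eval z m"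
proof -
  let ?A = "insert v (Poly_Mapping.keys m)"
  have "mon_eval (z(v := 2 * z v)) m
      = (\<Prod>w\<in>?A. (if w = v then 2 ^ Poly_Mapping.lookup m v else 1) * z w ^ Poly_Mapping.lookup m w)"
    by (subst mon_eval_superset[of ?A]) (auto intro!: prod.cong simp: power_mult_distrib)
  also have "\<dots> = 2 ^ Poly_Mapping.lookup m v * (\<Prod>w\<in>?A. z w ^ Poly_Mapping.lookup m w)"
    by (simp add: prod.distrib prod.delta)
  also have "(\<Prod>w\<in>?A. z w ^ Poly_Mapping.lookup m w) = mon_eval z m"
    by (subst mon_eval_superset[of ?A]) auto
  finally show ?thesis .
qed

text \<open>
  Artin's argument for characters. If \<open>v\<close> has different exponents in \<open>m\<close> and \<open>m0\<close>, then doubling the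
  coordinate \<open>v\<close> and subtracting a multiple of the original relation eliminates \<open>m0\<close> but not \<open>m\<close>.
\<close>

lemma mon_eval_independent:
  fixes c :: "'v monomial \<Rightarrow> complex"
  assumes "finite K" "\<And>z. (\<Sum>m\<in>K. c m * mon_eval z m) = 0"
  shows "\<forall>m\<in>K. c m = 0"
  using assms
proof (induction K arbitrary: c rule: finite_induct)
  case (insert m0 K)
  have K: "c m = 0" if "m \<in> K" for m
  proof -
    have "m \<noteq> m0" using that insert.hyps by blast
    then obtain v where v: "Poly_Mapping.lookup m v \<noteq> Poly_Mapping.lookup m0 v"
      by (meson poly_mapping_eqI)
    define e :: "'v monomial \<Rightarrow> complex" where "e m = 2 ^ Poly_Mapping.lookup m v" for m
    have "(\<Sum>m\<in>K. (c m * (e m - e m0)) * mon_eval z m) = 0" for z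
    proof -
      have "(\<Sum>m\<in>K. (c m * (e m - e m0)) * mon_eval z m)
          = (\<Sum>m\<in>insert m0 K. (c m * (e m - e m0)) * mon_eval z m)"
        using insert.hyps by simp
      also have "\<dots> = (\<Sum>m\<in>insert m0 K. c m * mon_eval (z(v := 2 * z v)) m)
          - e m0 * (\<Sum>m\<in>insert m0 K. c m * mon_eval z m)"
        unfolding mon_eval_scale_coordinate sum_distrib_left sum_subtractf[symmetric] e_def
        by (intro sum.cong) (simp_all add: algebra_simps)
      finally show ?thesis unfolding insert.prems by simp
    qed
    with insert.IH[of "\<lambda>m. c m * (e m - e m0)"] that have "c m * (e m - e m0) = 0" by blast
    moreover have "e m \<noteq> e m0"
    proof -
      have "(of_nat (2 ^ Poly_Mapping.lookup m v) :: complex) \<noteq> of_nat (2 ^ Poly_Mapping.lookup m0 v)"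
        using v by (subst of_nat_eq_iff) simp
      then show ?thesis by (simp add: e_def)
    qed
    ultimately show ?thesis by simp
  qed
  have "(\<Sum>m\<in>insert m0 K. c m * mon_eval (\<lambda>_. 1) m) = c m0"
    using K insert.hyps by (simp add: mon_eval_def)
  with K insert.prems[of "\<lambda>_. 1"] show ?case by simp
qed simp

lemma mpoly_nonzero_eval:
  assumes "H \<noteq> 0"
  obtains z where "mpoly_eval z H \<noteq> 0"
proof -
  have "\<exists>z. mpoly_eval z H \<noteq> 0"
  proof (rule ccontr)
    assume "\<nexists>z. mpoly_eval z H \<noteq> 0"
    then have "\<forall>m\<in>Poly_Mapping.keys H. Poly_Mapping.lookup H m = 0"
      by (intro mon_eval_independent) (auto simp: mpoly_eval_def)
    then have "H = 0" by (intro poly_mapping_eqI) (auto simp: in_keys_iff)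
    with assms show False by simp
  qed
  then show thesis using that by blast
qed

lemma nonvanishing_nonempty:
  assumes "H \<noteq> 0" "\<And>a. a \<in> Poly_Mapping.keys H \<Longrightarrow> Poly_Mapping.keys a \<subseteq> monomials n d"
  shows "nonvanishing n d H \<noteq> {}"
proof -
  obtain z where z: "mpoly_eval z H \<noteq> 0" using mpoly_nonzero_eval[OF assms(1)] .
  define F where "F = (\<Sum>m\<in>monomials n d. Poly_Mapping.single m (z m))"
  have F: "Poly_Mapping.lookup F m = (if m \<in> monomials n d then z m else 0)" for m
    using finite_monomials[of n d] by (simp add: F_def lookup_sum lookup_single when_def)
  then have "F \<in> forms n d" by (auto simp: forms_def in_keys_iff split: if_splits)
  moreover have "mpoly_eval (Poly_Mapping.lookup F) H = mpoly_eval z H"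
    using assms(2) by (intro mpoly_eval_cong) (auto simp: F)
  ultimately show ?thesis using z by (auto simp: nonvanishing_def)
qed


section \<open>The parametrization of sums of powers\<close>

text \<open>
  A form whose coefficients are polynomials in parameters, written as a list of terms that may repeat
  monomials: products of families are then given by products of terms, with nothing to collect.
  The bound on exponents is what the dimension count needs.
\<close>

definition polynomial_family ::
    "'v set \<Rightarrow> nat \<Rightarrow> (('v \<Rightarrow> complex) \<Rightarrow> nat mpoly) \<Rightarrow> bool" where
  "polynomial_family V k W \<longleftrightarrow>
     (\<exists>xs :: (nat monomial \<times> 'v mpoly) list. (\<forall>(m, P)\<in>set xs. Poly_Mapping.keys P \<subseteq> exponent_box V k) \<and>
        (\<forall>z. W z = (\<Sum>(m, P)\<leftarrow>xs. Poly_Mapping.single m (mpoly_eval z P))))"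

lemma polynomial_family_single:
  assumes "Poly_Mapping.keys P \<subseteq> exponent_box V k"
  shows "polynomial_family V k (\<lambda>z. Poly_Mapping.single m (mpoly_eval z P))"
  unfolding polynomial_family_def using assms by (intro exI[of _ "[(m, P)]"]) simp

lemma polynomial_family_0: "polynomial_family V k (\<lambda>_. 0)"
  unfolding polynomial_family_def by (intro exI[of _ "[]"]) simp

lemma polynomial_family_add:
  assumes "polynomial_family V k W" "polynomial_family V k W'"
  shows "polynomial_family V k (\<lambda>z. W z + W' z)"
proof -
  obtain xs ys where "\<forall>(m, P)\<in>set xs. Poly_Mapping.keys P \<subseteq> exponent_box V k"
    "\<And>z. W z = (\<Sum>(m, P)\<leftarrow>xs. Poly_Mapping.single m (mpoly_eval z P))"
    "\<forall>(m, P)\<in>set ys. Poly_Mapping.keys P \<subseteq> exponent_box V k"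
    "\<And>z. W' z = (\<Sum>(m, P)\<leftarrow>ys. Poly_Mapping.single m (mpoly_eval z P))"
    using assms unfolding polynomial_family_def by blast
  then show ?thesis
    unfolding polynomial_family_def by (intro exI[of _ "xs @ ys"]) auto
qed

lemma polynomial_family_sum:
  "finite I \<Longrightarrow> (\<And>i. i \<in> I \<Longrightarrow> polynomial_family V k (W i)) \<Longrightarrow>
    polynomial_family V k (\<lambda>z. \<Sum>i\<in>I. W i z)"
  by (induction I rule: finite_induct) (auto intro: polynomial_family_0 polynomial_family_add)

lemma polynomial_family_mult:
  assumes "polynomial_family V k W" "polynomial_family V l W'"
  shows "polynomial_family V (k + l) (\<lambda>z. W z * W' z)"
proof -
  obtain xs ys where xs: "\<forall>(m, P)\<in>set xs. Poly_Mapping.keys P \<subseteq> exponent_box V k"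
    "\<And>z. W z = (\<Sum>(m, P)\<leftarrow>xs. Poly_Mapping.single m (mpoly_eval z P))"
    and ys: "\<forall>(m, P)\<in>set ys. Poly_Mapping.keys P \<subseteq> exponent_box V l"
    "\<And>z. W' z = (\<Sum>(m, P)\<leftarrow>ys. Poly_Mapping.single m (mpoly_eval z P))"
    using assms unfolding polynomial_family_def by blast
  define zs where "zs = [(fst x + fst y, snd x * snd y). x \<leftarrow> xs, y \<leftarrow> ys]"
  have "\<forall>(m, P)\<in>set zs. Poly_Mapping.keys P \<subseteq> exponent_box V (k + l)"
  proof
    fix x assume "x \<in> set zs"
    then obtain a b where "a \<in> set xs" "b \<in> set ys" "x = (fst a + fst b, snd a * snd b)"
      by (auto simp: zs_def)
    then show "case x of (m, P) \<Rightarrow> Poly_Mapping.keys P \<subseteq> exponent_box V (k + l)"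
      using xs(1) ys(1) keys_mult_exponent_box[of "snd a" V k "snd b" l] by (auto simp: split_beta)
  qed
  moreover have "(\<Sum>(m, P)\<leftarrow>xs. Poly_Mapping.single m (mpoly_eval z P)) *
        (\<Sum>(m, P)\<leftarrow>ys. Poly_Mapping.single m (mpoly_eval z P))
      = (\<Sum>(m, P)\<leftarrow>zs. Poly_Mapping.single m (mpoly_eval z P))" for z
  proof -
    have row: "Poly_Mapping.single a (mpoly_eval z A) *
          (\<Sum>(m, P)\<leftarrow>ys. Poly_Mapping.single m (mpoly_eval z P))
        = (\<Sum>(m, P)\<leftarrow>map (\<lambda>y. (a + fst y, A * snd y)) ys. Poly_Mapping.single m (mpoly_eval z P))"
      for a A by (induction ys) (auto simp: distrib_left mult_single mpoly_eval_mult)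
    show ?thesis
      unfolding zs_def by (induction xs) (auto simp: distrib_right row)
  qed
  ultimately show ?thesis
    unfolding polynomial_family_def using xs(2) ys(2) by (intro exI[of _ zs]) auto
qed

lemma polynomial_family_power:
  assumes "polynomial_family V k W"
  shows "polynomial_family V (e * k) (\<lambda>z. W z ^ e)"
proof (induction e)
  case 0
  have "polynomial_family V 0 (\<lambda>z. Poly_Mapping.single 0 (mpoly_eval z (1 :: 'a mpoly)))"
    by (rule polynomial_family_single) (rule keys_1_exponent_box)
  then show ?case by (simp add: mpoly_eval_1)
next
  case (Suc e)
  then show ?case using polynomial_family_mult[OF assms Suc] by simp
qed

lemma polynomial_family_lookup:
  assumes "polynomial_family V k W"
  shows "\<exists>M P. finite M \<and> (\<forall>z. Poly_Mapping.keys (W z) \<subseteq> M) \<and>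
    (\<forall>m. Poly_Mapping.keys (P m) \<subseteq> exponent_box V k) \<and>
    (\<forall>z m. Poly_Mapping.lookup (W z) m = mpoly_eval z (P m))"
proof -
  obtain xs where xs: "\<forall>(m, P)\<in>set xs. Poly_Mapping.keys P \<subseteq> exponent_box V k"
    "\<And>z. W z = (\<Sum>(m, P)\<leftarrow>xs. Poly_Mapping.single m (mpoly_eval z P))"
    using assms unfolding polynomial_family_def by blast
  define P where "P m = (\<Sum>x\<leftarrow>xs. if fst x = m then snd x else 0)" for m
  have lookup: "Poly_Mapping.lookup (\<Sum>(m, P)\<leftarrow>xs. Poly_Mapping.single m (mpoly_eval z P)) m
      = mpoly_eval z (\<Sum>x\<leftarrow>xs. if fst x = m then snd x else 0)" for z m
    by (induction xs) (auto simp: mpoly_eval_simps lookup_add lookup_single when_def)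
  show ?thesis
  proof (intro exI[of _ "fst ` set xs"] exI[of _ P] conjI allI)
    show "Poly_Mapping.lookup (W z) m = mpoly_eval z (P m)" for z m
      unfolding P_def xs(2) by (rule lookup)
    have coeff: "(\<Sum>x\<leftarrow>xs. if fst x = m then snd x else 0) = 0" if "m \<notin> fst ` set xs" for m
      using that by (induction xs) auto
    have zero: "Poly_Mapping.lookup (W z) m = 0" if "m \<notin> fst ` set xs" for z m
      using coeff[OF that] by (simp only: xs(2) lookup mpoly_eval_0)
    show "Poly_Mapping.keys (W z) \<subseteq> fst ` set xs" for z
    proof
      fix m assume "m \<in> Poly_Mapping.keys (W z)"
      then show "m \<in> fst ` set xs" using zero[of m z] unfolding in_keys_iff by blast
    qed
    show "Poly_Mapping.keys (P m) \<subseteq> exponent_box V k" for m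
      unfolding P_def using xs(1)
    proof (induction xs)
      case (Cons x xs)
      then have "Poly_Mapping.keys (\<Sum>x\<leftarrow>xs. if fst x = m then snd x else 0) \<subseteq> exponent_box V k"
        and "Poly_Mapping.keys (snd x) \<subseteq> exponent_box V k"
        by (auto simp: split_beta)
      moreover from this have "Poly_Mapping.keys (if fst x = m then snd x else 0) \<subseteq> exponent_box V k"
        by simp
      ultimately show ?case
        using Poly_Mapping.keys_add[of "if fst x = m then snd x else 0"
            "\<Sum>x\<leftarrow>xs. if fst x = m then snd x else 0"]
        unfolding list.map sum_list.Cons by blast
    qed simp
  qed simp
qed

text \<open>
  The parameters \<open>(i, j)\<close> with \<open>j < n\<close> are the coefficients of the \<open>i\<close>-th linear form, and \<open>(i, n)\<close> is its
  scalar, which makes \<open>r * (n + 1)\<close> parameters in all.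
\<close>

definition waring_map :: "nat \<Rightarrow> nat \<Rightarrow> nat \<Rightarrow> (nat \<times> nat \<Rightarrow> complex) \<Rightarrow> nat mpoly" where
  "waring_map n d r z = (\<Sum>i<r. const (z (i, n)) *
     (\<Sum>j<n. Poly_Mapping.single (Poly_Mapping.single j 1) (z (i, j))) ^ d)"

lemma linear_form_eq:
  assumes "l \<in> forms n 1"
  shows "l = (\<Sum>j<n. Poly_Mapping.single (Poly_Mapping.single j 1)
    (Poly_Mapping.lookup l (Poly_Mapping.single j 1)))"
proof -
  have "l = (\<Sum>m\<in>monomials n 1. Poly_Mapping.single m (Poly_Mapping.lookup l m))"
    using assms finite_monomials[of n 1]
    by (intro poly_mapping_eqI) (auto simp: lookup_sum lookup_single when_def forms_def in_keys_iff)
  also have "inj_on (\<lambda>v. Poly_Mapping.single v (1::nat)) {..<n}"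
    by (rule inj_onI) (metis lookup_single_eq lookup_single_not_eq zero_neq_one)
  then have "(\<Sum>m\<in>monomials n 1. Poly_Mapping.single m (Poly_Mapping.lookup l m))
      = (\<Sum>j<n. Poly_Mapping.single (Poly_Mapping.single j 1)
          (Poly_Mapping.lookup l (Poly_Mapping.single j 1)))"
    unfolding monomials_1 by (subst sum.reindex) auto
  finally show ?thesis .
qed

lemma power_sum_iff_waring_map: "power_sum n d r F \<longleftrightarrow> (\<exists>z. F = waring_map n d r z)"
proof
  assume "power_sum n d r F"
  then obtain c l where l: "\<forall>i<r. l i \<in> forms n 1" "F = (\<Sum>i<r. const (c i) * l i ^ d)"
    unfolding power_sum_def by blast
  define z where "z = (\<lambda>(i, j). if j = n then c i
    else Poly_Mapping.lookup (l i) (Poly_Mapping.single j 1))"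
  have "(\<Sum>j<n. Poly_Mapping.single (Poly_Mapping.single j 1) (z (i, j))) = l i" if "i < r" for i
    using l(1) that linear_form_eq[of "l i" n] by (simp add: z_def)
  then have "F = waring_map n d r z"
    unfolding waring_map_def l(2) by (intro sum.cong) (auto simp: z_def)
  then show "\<exists>z. F = waring_map n d r z" by blast
next
  assume "\<exists>z. F = waring_map n d r z"
  then obtain z where F: "F = waring_map n d r z" by blast
  have "(\<Sum>j<n. Poly_Mapping.single (Poly_Mapping.single j 1) (z (i, j))) \<in> forms n 1" for i
  proof -
    have mem: "Poly_Mapping.single (Poly_Mapping.single j 1) (z (i, j)) \<in> forms n 1" if "j < n" for j
      using that by (auto simp: forms_def monomials_1 simp del: One_nat_def)
    have "(\<Sum>j\<in>J. Poly_Mapping.single (Poly_Mapping.single j 1) (z (i, j))) \<in> forms n 1"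
      if "finite J" "J \<subseteq> {..<n}" for J
      using that
      by (induction J rule: finite_induct) (auto intro!: zero_in_forms forms_add mem simp del: One_nat_def)
    then show ?thesis by blast
  qed
  then show "power_sum n d r F"
    unfolding power_sum_def F waring_map_def
    by (intro exI[of _ "\<lambda>i. z (i, n)"]
        exI[of _ "\<lambda>i. \<Sum>j<n. Poly_Mapping.single (Poly_Mapping.single j 1) (z (i, j))"]) simp
qed

lemma polynomial_family_waring_map:
  "polynomial_family ({..<r} \<times> {..n}) (1 + d) (waring_map n d r)"
proof -
  have var: "Poly_Mapping.keys (var v) \<subseteq> exponent_box V 1" if "v \<in> V" for v :: "nat \<times> nat" and V
    using that by (simp add: var_def exponent_box_def lookup_single when_def)
  have "polynomial_family ({..<r} \<times> {..n}) (1 + d * 1) (\<lambda>z. \<Sum>i<r.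
      Poly_Mapping.single 0 (mpoly_eval z (var (i, n))) *
     (\<Sum>j<n. Poly_Mapping.single (Poly_Mapping.single j 1) (mpoly_eval z (var (i, j)))) ^ d)"
    by (intro polynomial_family_sum polynomial_family_mult polynomial_family_power
        polynomial_family_single var) auto
  then show ?thesis by (simp add: waring_map_def[abs_def] const_def)
qed

text \<open>
  Too few parameters: the coefficients of a sum of \<open>r\<close> powers are then algebraically dependent.
\<close>

lemma power_sum_not_generic:
  assumes "r * (n + 1) < card (monomials n d)"
  shows "\<exists>h. nonvanishing n d h \<noteq> {} \<and> (\<forall>F\<in>nonvanishing n d h. \<not> power_sum n d r F)"
proof -
  from polynomial_family_lookup[OF polynomial_family_waring_map[of r n d]] obtain M P where
    MP: "finite M \<and> (\<forall>z. Poly_Mapping.keys (waring_map n d r z) \<subseteq> M) \<and>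
      (\<forall>m. Poly_Mapping.keys (P m) \<subseteq> exponent_box ({..<r} \<times> {..n}) (1 + d)) \<and>
      (\<forall>z m. Poly_Mapping.lookup (waring_map n d r z) m = mpoly_eval z (P m))"
    by (elim exE)
  have P: "Poly_Mapping.keys (P m) \<subseteq> exponent_box ({..<r} \<times> {..n}) (1 + d)" for m
    using MP by simp
  have eval: "Poly_Mapping.lookup (waring_map n d r z) m = mpoly_eval z (P m)" for z m
    using MP by simp
  have card: "card ({..<r} \<times> {..n}) < card (monomials n d)" using assms by simp
  have fin: "finite ({..<r} \<times> {..n})" by simp
  show ?thesis
  proof (rule algebraic_dependence[OF finite_monomials fin card P])
    fix H :: "nat monomial mpoly"
    assume H: "H \<noteq> 0"
      "\<And>a. a \<in> Poly_Mapping.keys H \<Longrightarrow> Poly_Mapping.keys a \<subseteq> monomials n d"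
      "\<And>z w. (\<And>m. m \<in> monomials n d \<Longrightarrow> w m = mpoly_eval z (P m)) \<Longrightarrow> mpoly_eval w H = 0"
    have "\<not> power_sum n d r F" if F: "F \<in> nonvanishing n d H" for F
    proof
      assume "power_sum n d r F"
      then obtain z where "F = waring_map n d r z" by (auto simp: power_sum_iff_waring_map)
      then have "mpoly_eval (Poly_Mapping.lookup F) H = 0" by (intro H(3)[of _ z]) (simp add: eval)
      with F show False by (simp add: nonvanishing_def)
    qed
    then show ?thesis using nonvanishing_nonempty[OF H(1,2)] by blast
  qed
qed

lemma power_sum_dichotomy:
  "(\<exists>g. nonvanishing n d g \<noteq> {} \<and> (\<forall>F\<in>nonvanishing n d g. power_sum n d r F)) \<or>
   (\<exists>h. nonvanishing n d h \<noteq> {} \<and> (\<forall>F\<in>nonvanishing n d h. \<not> power_sum n d r F))"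
proof -
  from polynomial_family_lookup[OF polynomial_family_waring_map[of r n d]] obtain M P where
    MP: "finite M \<and> (\<forall>z. Poly_Mapping.keys (waring_map n d r z) \<subseteq> M) \<and>
      (\<forall>m. Poly_Mapping.keys (P m) \<subseteq> exponent_box ({..<r} \<times> {..n}) (1 + d)) \<and>
      (\<forall>z m. Poly_Mapping.lookup (waring_map n d r z) m = mpoly_eval z (P m))"
    by (elim exE)
  then have M: "finite M" "\<And>z. Poly_Mapping.keys (waring_map n d r z) \<subseteq> M" by simp_all
  have eval: "Poly_Mapping.lookup (waring_map n d r z) m = mpoly_eval z (P m)" for z m
    using MP by simp
  \<comment> \<open>Both \<open>F\<close> and all sums of powers are supported in the finite set \<open>M'\<close>, so equality with a
     sum of powers amounts to finitely many equations.\<close>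
  define M' where "M' = M \<union> monomials n d"
  define T where "T = {w. \<exists>z. \<forall>m\<in>M'. w m = mpoly_eval z (P m)}"
  have "constructible T"
    unfolding T_def M'_def using M finite_monomials by (intro constructible_image) auto
  moreover have "Poly_Mapping.lookup F \<in> T \<longleftrightarrow> power_sum n d r F" if "F \<in> forms n d" for F
  proof -
    have "F = waring_map n d r z \<longleftrightarrow> (\<forall>m\<in>M'. Poly_Mapping.lookup F m = mpoly_eval z (P m))" for z
    proof
      assume *: "\<forall>m\<in>M'. Poly_Mapping.lookup F m = mpoly_eval z (P m)"
      show "F = waring_map n d r z"
      proof (rule poly_mapping_eqI)
        fix m
        show "Poly_Mapping.lookup F m = Poly_Mapping.lookup (waring_map n d r z) m"
        proof (cases "m \<in> M'")
          case False
          then have "m \<notin> Poly_Mapping.keys F" "m \<notin> Poly_Mapping.keys (waring_map n d r z)"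
            using that M(2)[of z] by (auto simp: M'_def forms_def)
          then show ?thesis by (simp add: in_keys_iff)
        qed (use * eval in simp)
      qed
    qed (simp add: eval)
    then show ?thesis by (simp add: T_def power_sum_iff_waring_map)
  qed
  ultimately show ?thesis
    using constructible_forms_dichotomy[of T n d] by (auto simp: nonvanishing_def)
qed


section \<open>The generic Waring rank\<close>

text \<open>
  Sums of \<open>r\<close> powers contain a nonempty open set for some \<open>r\<close>, because every form is a sum of powers of
  bounded length. If the least such \<open>r\<close> is positive, the dichotomy yields another nonempty
  open set without sums of \<open>r - 1\<close> powers, and on the intersection the rank is \<open>r\<close>. No other value is possible since dense open sets meet.
\<close>

lemma generic_waring_rank_attained:
  "\<exists>g. nonvanishing n d g \<noteq> {} \<and>
    (\<forall>F\<in>nonvanishing n d g. waring_rank n d F = generic_waring_rank n d \<and>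
       power_sum n d (generic_waring_rank n d) F)"
proof -
  define generic where "generic r \<longleftrightarrow> (\<exists>g. nonvanishing n d g \<noteq> {} \<and>
    (\<forall>F\<in>nonvanishing n d g. power_sum n d r F))" for r
  have "generic (card (monomials n d) * 2 ^ d)"
    unfolding generic_def
  proof (intro exI conjI ballI)
    show "nonvanishing n d 1 \<noteq> {}" by (rule nonvanishing_1)
    fix F assume "F \<in> nonvanishing n d 1"
    then have F: "F \<in> forms n d" by (simp add: nonvanishing_def)
    then have "card (Poly_Mapping.keys F) \<le> card (monomials n d)"
      by (intro card_mono finite_monomials) (simp add: forms_def)
    then show "power_sum n d (card (monomials n d) * 2 ^ d) F"
      by (intro power_sum_mono[OF power_sum_forms[OF F]]) simp
  qed
  define r where "r = (LEAST r. generic r)"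
  have "generic r" unfolding r_def by (rule LeastI) fact
  then obtain g where g: "nonvanishing n d g \<noteq> {}" "\<forall>F\<in>nonvanishing n d g. power_sum n d r F"
    unfolding generic_def by blast
  have "\<exists>h. nonvanishing n d h \<noteq> {} \<and> (\<forall>F\<in>nonvanishing n d h. \<forall>s<r. \<not> power_sum n d s F)"
  proof (cases r)
    case 0
    then show ?thesis using nonvanishing_1 by blast
  next
    case (Suc s)
    then have "\<not> generic s" unfolding r_def by (intro not_less_Least) simp
    then obtain h where "nonvanishing n d h \<noteq> {}" "\<forall>F\<in>nonvanishing n d h. \<not> power_sum n d s F"
      using power_sum_dichotomy unfolding generic_def by blast
    then show ?thesis using Suc power_sum_mono by (metis less_Suc_eq_le)
  qed
  then obtain h where h: "nonvanishing n d h \<noteq> {}"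
    "\<forall>F\<in>nonvanishing n d h. \<forall>s<r. \<not> power_sum n d s F" by blast
  define U where "U = nonvanishing n d (g * h)"
  have U: "openin (zariski n d) U" "U \<noteq> {}"
    using nonvanishing_mult[OF g(1) h(1)] by (auto simp: U_def openin_nonvanishing)
  have rank: "waring_rank n d F = r" and sum: "power_sum n d r F" if "F \<in> U" for F
  proof -
    from that have "power_sum n d r F" "\<forall>s<r. \<not> power_sum n d s F"
      using g(2) h(2) by (auto simp: U_def nonvanishing_mult_eq_Int)
    then show "power_sum n d r F" "waring_rank n d F = r"
      unfolding waring_rank_eq by (auto intro!: Least_equality simp: not_less[symmetric])
  qed
  have "generic_waring_rank n d = r"
    unfolding generic_waring_rank_def
  proof (rule the_equality)
    show "\<exists>U. openin (zariski n d) U \<and> zariski n d closure_of U = topspace (zariski n d) \<and>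
        (\<forall>F\<in>U. waring_rank n d F = r)"
      using U rank zariski_dense[OF U] by blast
  next
    fix s assume "\<exists>U. openin (zariski n d) U \<and>
      zariski n d closure_of U = topspace (zariski n d) \<and> (\<forall>F\<in>U. waring_rank n d F = s)"
    then obtain U' where U': "openin (zariski n d) U'"
      "zariski n d closure_of U' = topspace (zariski n d)" "\<forall>F\<in>U'. waring_rank n d F = s" by blast
    have "U' \<noteq> {}"
    proof
      assume "U' = {}"
      with U'(2) have "forms n d = {}" by (simp add: topspace_zariski)
      with zero_in_forms show False by blast
    qed
    with zariski_open_Int_nonempty[OF U U'(1)] obtain F where "F \<in> U" "F \<in> U'" by blast
    with rank U'(3) show "s = r" by metis
  qed
  with U rank sum show ?thesis by (intro exI[of _ "g * h"]) (simp add: U_def)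
qed

lemma card_monomials_le_generic_waring_rank:
  "card (monomials n d) \<le> generic_waring_rank n d * (n + 1)"
proof (rule ccontr)
  assume "\<not> ?thesis"
  then have "generic_waring_rank n d * (n + 1) < card (monomials n d)" by simp
  then obtain h where h: "nonvanishing n d h \<noteq> {}"
    "\<forall>F\<in>nonvanishing n d h. \<not> power_sum n d (generic_waring_rank n d) F"
    using power_sum_not_generic by blast
  obtain g where g: "nonvanishing n d g \<noteq> {}"
    "\<forall>F\<in>nonvanishing n d g. power_sum n d (generic_waring_rank n d) F"
    using generic_waring_rank_attained[of n d] by blast
  from nonvanishing_mult[OF g(1) h(1)] g(2) h(2) show False
    by (auto simp: nonvanishing_mult_eq_Int)
qed


section \<open>The asymptotic comparison\<close>

theorem mainTheorem4:
  fixes d :: nat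
  assumes "d \<ge> 3"
  shows "(\<lambda>n. real (max_coprime_waring_rank n d) / real (generic_waring_rank n d))
           \<longlonglongrightarrow> 0"
proof (rule Lim_null_comparison)
  define C where "C = 2 ^ d * real d ^ 3"
  show "\<forall>\<^sub>F n in sequentially.
      norm (real (max_coprime_waring_rank n d) / real (generic_waring_rank n d)) \<le> 2 * C / real n"
    using eventually_ge_at_top[of d]
  proof eventually_elim
    case (elim n)
    then have n: "n \<ge> 1" "d \<ge> 1" "n > 0" using assms by auto
    \<comment> \<open>The cube is the smallest power that beats the two factors \<open>n\<close> coming from the numerator and from
       the number of parameters of a linear form.\<close>
    have "(real n / real d) ^ 3 \<le> (real n / real d) ^ d"
      using elim assms n by (intro power_increasing) auto
    also have "\<dots> \<le> real (n choose d)"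
      by (rule binomial_ge_n_over_k_pow_k) (rule elim)
    also have "\<dots> \<le> real (generic_waring_rank n d * (n + 1))"
      using card_monomials_ge[of n d] card_monomials_le_generic_waring_rank[of n d] by linarith
    also have "\<dots> \<le> real (generic_waring_rank n d) * (2 * real n)"
      unfolding of_nat_mult using n by (intro mult_left_mono) simp_all
    finally have g: "real n ^ 2 / (2 * real d ^ 3) \<le> real (generic_waring_rank n d)"
      using n by (simp add: field_simps power3_eq_cube power2_eq_square)
    have m: "real (max_coprime_waring_rank n d) \<le> real n * 2 ^ d"
      using max_coprime_waring_rank_le[OF n(2,1)] by (metis of_nat_le_iff of_nat_mult of_nat_numeral of_nat_power)
    have "real (max_coprime_waring_rank n d) / real (generic_waring_rank n d)
        \<le> (real n * 2 ^ d) / (real n ^ 2 / (2 * real d ^ 3))"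
      using g m n by (intro frac_le) auto
    also have "\<dots> = 2 * C / real n"
      using n by (simp add: C_def field_simps power2_eq_square)
    finally show ?case by simp
  qed
  show "(\<lambda>n. 2 * C / real n) \<longlonglongrightarrow> 0" by (rule lim_const_over_n)
qed

end
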